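(* Let $W$ be a subset of $\mathbf{Gr}_{S_m}^{q}$. (i) If $\overline W$ is the closure of $W$, then $\mathbf{in}(W)=\mathbf{in}(\overline W)$ and $\mathbf{gin}(W)=\mathbf{gin}(\overline W)$. (ii) If $W$ is closed and $\widetilde W$ is the set of its closed points, then $\mathbf{in}(W)=\mathbf{in}(\widetilde W)$ and $\mathbf{gin}(W)=\mathbf{gin}(\widetilde W)$. (iii) If $W$ is closed and irreducible and $V$ is its generic point, then $\mathbf{in}(W)=\mathbf{in}(V)$ and $\mathbf{gin}(W)=\mathbf{gin}(V)$.
   Context: $K$ is an infinite field, $S=K[x_0,\dots,x_n]$ with the standard grading, $S_m$ is its degree $m$ component, a term is a monic monomial, $\prec$ is a term order on $S$ with $x_0\prec\dots\prec x_n$, $m,q$ are positive integers. $\mathbf{Gr}_{S_m}^{q}$ is the Grassmannian scheme over $K$ of $q$-dimensional subspaces of $S_m$, embedded in $\mathbb P(\wedge^qS_m)$ by Plücker. "Subset" means non-empty set of (not necessarily closed) points of the scheme. $\mathbf T_{S_m}^{q}$ is the set of $\tau_1\wedge\dots\wedge\tau_q$ with $\tau_i$ terms in $S_m$, $\tau_1\succ\dots\succ\tau_q$, totally ordered by: $\tau_1\wedge\dots\wedge\tau_q\prec\sigma_1\wedge\dots\wedge\sigma_q$ iff for some $j$, $\tau_i=\sigma_i$ for $i<j$ and $\tau_j\prec\sigma_j$. For $L\in\mathbf T_{S_m}^{q}$, $U_L\subseteq\mathbf{Gr}_{S_m}^{q}$ is the open set where the Plücker coordinate $\Delta_L$ is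 invertible. $\mathrm{GL}=\mathrm{GL}_K(n+1)$ acts on $S$ by $g(f)=f(\sum_j g_{0j}x_j,\dots,\sum_j g_{nj}x_j)$ and correspondingly, by automorphisms, on $\mathbf{Gr}_{S_m}^{q}$; $\mathcal O(W)=\{g(V):V\in W,\ g\in\mathrm{GL}\}$. $\Delta\mathrm{Supp}(W)=\{L\in\mathbf T_{S_m}^{q}:U_L\cap W\ne\emptyset\}$, $\mathbf{in}(W)=\max_\prec\Delta\mathrm{Supp}(W)$, $\mathbf{gin}(W)=\max_\prec\Delta\mathrm{Supp}(\mathcal O(W))$; for $W=\{V\}$ one writes $\mathbf{in}(V),\mathbf{gin}(V)$. *)

theory Defs
  imports
    "HOL-Library.Poly_Mapping"
    "HOL-Algebra.Ideal"
    "HOL-Analysis.Abstract_Topology"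
    "Jordan_Normal_Form.Determinant"
begin

section \<open>Polynomials\<close>

text \<open>
  A monomial in variables of type \<open>'v\<close> is a finitely supported exponent vector
  \<open>'v \<Rightarrow>\<^sub>0 nat\<close>, a polynomial over \<open>'k\<close> is a finitely supported map from monomials to
  coefficients, with the convolution product of \<open>HOL-Library.Poly_Mapping\<close>.
\<close>

type_synonym 'v monom = "'v \<Rightarrow>\<^sub>0 nat"
type_synonym ('v, 'k) mpoly = "'v monom \<Rightarrow>\<^sub>0 'k"

definition mdeg :: "'v monom \<Rightarrow> nat"
  where "mdeg t = (\<Sum>v\<in>Poly_Mapping.keys t. Poly_Mapping.lookup t v)"

definition Const :: "'k \<Rightarrow> ('v, 'k::comm_ring_1) mpoly"
  where "Const c = Poly_Mapping.single 0 c"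

definition Var :: "'v \<Rightarrow> ('v, 'k::comm_ring_1) mpoly"
  where "Var v = Poly_Mapping.single (Poly_Mapping.single v 1) 1"

text \<open>\<open>psubst \<sigma>\<close> is the homomorphism of \<open>'k\<close>-algebras sending each variable \<open>v\<close> to \<open>\<sigma> v\<close>.\<close>

definition psubst :: "('v \<Rightarrow> ('w, 'k) mpoly) \<Rightarrow> ('v, 'k::comm_ring_1) mpoly \<Rightarrow> ('w, 'k) mpoly"
  where "psubst \<sigma> p = (\<Sum>t\<in>Poly_Mapping.keys p. Const (Poly_Mapping.lookup p t) *
           (\<Prod>v\<in>Poly_Mapping.keys t. \<sigma> v ^ Poly_Mapping.lookup t v))"

definition poly_ring :: "'v set \<Rightarrow> ('v, 'k::comm_ring_1) mpoly ring"
  where "poly_ring T = \<lparr>carrier = {p. \<forall>t\<in>Poly_Mapping.keys p. Poly_Mapping.keys t \<subseteq> T},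
           monoid.mult = (*), one = 1, zero = 0, add = (+)\<rparr>"

definition hom_component :: "nat \<Rightarrow> ('v, 'k::comm_ring_1) mpoly \<Rightarrow> ('v, 'k) mpoly"
  where "hom_component d p = (\<Sum>t\<in>{t \<in> Poly_Mapping.keys p. mdeg t = d}.
           Poly_Mapping.single t (Poly_Mapping.lookup p t))"

definition homogeneous_set :: "('v, 'k::comm_ring_1) mpoly set \<Rightarrow> bool"
  where "homogeneous_set I \<longleftrightarrow> (\<forall>p\<in>I. \<forall>d. hom_component d p \<in> I)"

lemma cring_poly_ring: "cring (poly_ring T :: ('v, 'k::comm_ring_1) mpoly ring)"
proof -
  let ?R = "poly_ring T :: ('v, 'k) mpoly ring"
  have add: "p + r \<in> carrier ?R" if "p \<in> carrier ?R" "r \<in> carrier ?R" for p r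
    using that keys_add[of p r] unfolding poly_ring_def by auto
  have uminus: "- p \<in> carrier ?R" if "p \<in> carrier ?R" for p
    using that unfolding poly_ring_def by (auto simp: in_keys_iff)
  have mult: "p * r \<in> carrier ?R" if "p \<in> carrier ?R" "r \<in> carrier ?R" for p r
  proof -
    have "Poly_Mapping.keys t \<subseteq> T" if t: "t \<in> Poly_Mapping.keys (p * r)" for t
    proof -
      obtain a b where "t = a + b" "a \<in> Poly_Mapping.keys p" "b \<in> Poly_Mapping.keys r"
        using keys_mult[of p r] t by auto
      then show ?thesis
        using \<open>p \<in> carrier ?R\<close> \<open>r \<in> carrier ?R\<close> keys_add[of a b]
        unfolding poly_ring_def by fastforce
    qed
    then show ?thesis unfolding poly_ring_def by auto
  qed
  have ops: "x \<otimes>\<^bsub>?R\<^esub> y = x * y" "x \<oplus>\<^bsub>?R\<^esub> y = x + y" "\<one>\<^bsub>?R\<^esub> = 1" "\<zero>\<^bsub>?R\<^esub> = 0" for x y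
    by (simp_all add: poly_ring_def)
  have zero: "0 \<in> carrier ?R" and one: "1 \<in> carrier ?R"
    by (auto simp: poly_ring_def)
  show ?thesis
  proof (rule cringI)
    show "abelian_group ?R"
    proof (rule abelian_groupI)
      fix x assume "x \<in> carrier ?R"
      then show "\<exists>y\<in>carrier ?R. y \<oplus>\<^bsub>?R\<^esub> x = \<zero>\<^bsub>?R\<^esub>"
        using uminus by (intro bexI[of _ "- x"]) (auto simp: ops)
    qed (auto simp: ops add zero algebra_simps)
    show "comm_monoid ?R"
      by (rule comm_monoidI) (auto simp: ops mult one algebra_simps)
  qed (auto simp: ops algebra_simps)
qed

section \<open>Terms and their exterior products\<close>

text \<open>The terms of \<open>S = K[x\<^sub>0, \<dots>, x\<^sub>n]\<close>, and those of degree \<open>m\<close>, a basis of \<open>S\<^sub>m\<close>.\<close>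

definition terms :: "nat \<Rightarrow> nat monom set"
  where "terms n = {t. Poly_Mapping.keys t \<subseteq> {..n}}"

definition terms_deg :: "nat \<Rightarrow> nat \<Rightarrow> nat monom set"
  where "terms_deg n m = {t \<in> terms n. mdeg t = m}"

text \<open>Orders are given as relations: \<open>(s, t) \<in> r\<close> stands for \<open>s \<prec> t\<close>.\<close>

definition term_order :: "nat \<Rightarrow> nat monom rel \<Rightarrow> bool"
  where "term_order n r \<longleftrightarrow>
    r \<subseteq> terms n \<times> terms n \<and>
    strict_linear_order_on (terms n) r \<and>
    (\<forall>t\<in>terms n. t \<noteq> 0 \<longrightarrow> (0, t) \<in> r) \<and>
    (\<forall>s\<in>terms n. \<forall>t\<in>terms n. \<forall>u\<in>terms n. (s, t) \<in> r \<longrightarrow> (s + u, t + u) \<in> r)"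

text \<open>
  The exterior product \<open>\<tau>\<^sub>1 \<and> \<dots> \<and> \<tau>\<^sub>q\<close> with \<open>\<tau>\<^sub>1 \<succ> \<dots> \<succ> \<tau>\<^sub>q\<close> is represented by the list
  \<open>[\<tau>\<^sub>1, \<dots>, \<tau>\<^sub>q]\<close>. The order on these lists is \<open>lex r\<close>, which compares lists of equal length
  at the first position where they differ.
\<close>

type_synonym ext_term = "nat monom list"

definition ext_terms :: "nat \<Rightarrow> nat \<Rightarrow> nat \<Rightarrow> nat monom rel \<Rightarrow> ext_term set"
  where "ext_terms n m q r =
    {L. length L = q \<and> set L \<subseteq> terms_deg n m \<and> sorted_wrt (\<lambda>s t. (t, s) \<in> r) L}"

section \<open>The Grassmannian\<close>

text \<open>
  \<open>\<P>(\<and>\<^sup>q S\<^sub>m)\<close> is \<open>Proj\<close> of the polynomial ring in the Pluecker coordinates \<open>\<Delta>\<^sub>L\<close>, one variable for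
  each \<open>L \<in> ext_terms n m q r\<close>. The Pluecker ideal consists of the polynomial relations between
  the maximal minors of the generic matrix with rows \<open>1, \<dots>, q\<close> and columns the terms of \<open>S\<^sub>m\<close>.
  The points of the Grassmannian scheme are the points of \<open>Proj\<close> at which this ideal vanishes,
  that is the relevant homogeneous prime ideals containing it.
\<close>

type_synonym 'k pl_poly = "(ext_term, 'k) mpoly"
type_synonym 'k point = "'k pl_poly set"

definition pl_ring :: "nat \<Rightarrow> nat \<Rightarrow> nat \<Rightarrow> nat monom rel \<Rightarrow> 'k::field pl_poly ring"
  where "pl_ring n m q r = poly_ring (ext_terms n m q r)"

definition generic_minor :: "nat \<Rightarrow> ext_term \<Rightarrow> (nat \<times> nat monom, 'k::field) mpoly"
  where "generic_minor q L = det (mat q q (\<lambda>(i, j). Var (i, L ! j)))"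

definition pl_ideal :: "nat \<Rightarrow> nat \<Rightarrow> nat \<Rightarrow> nat monom rel \<Rightarrow> 'k::field pl_poly set"
  where "pl_ideal n m q r = {p \<in> carrier (pl_ring n m q r). psubst (generic_minor q) p = 0}"

definition Gr :: "nat \<Rightarrow> nat \<Rightarrow> nat \<Rightarrow> nat monom rel \<Rightarrow> 'k::field point set"
  where "Gr n m q r =
    {P. primeideal P (pl_ring n m q r) \<and> homogeneous_set P \<and>
        \<not> Var ` ext_terms n m q r \<subseteq> P \<and> pl_ideal n m q r \<subseteq> P}"

text \<open>
  Zariski topology: the closed sets are the \<open>{P. E \<subseteq> P}\<close>. Since the points are homogeneous,
  allowing arbitrary instead of homogeneous \<open>E\<close> gives no further closed sets.
\<close>

definition zariski_open :: "nat \<Rightarrow> nat \<Rightarrow> nat \<Rightarrow> nat monom rel \<Rightarrow> 'k::field point set \<Rightarrow> bool"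
  where "zariski_open n m q r U \<longleftrightarrow>
    (\<exists>E \<subseteq> carrier (pl_ring n m q r). U = {P \<in> Gr n m q r. \<not> E \<subseteq> P})"

definition Gr_top :: "nat \<Rightarrow> nat \<Rightarrow> nat \<Rightarrow> nat monom rel \<Rightarrow> 'k::field point topology"
  where "Gr_top n m q r = topology (zariski_open n m q r)"

lemma istopology_zariski:
  "istopology (zariski_open n m q r :: 'k::field point set \<Rightarrow> bool)"
  unfolding istopology_def
proof (intro conjI allI impI)
  let ?R = "pl_ring n m q r :: 'k pl_poly ring"
  let ?Z = "zariski_open n m q r :: 'k point set \<Rightarrow> bool"
  interpret R: cring ?R unfolding pl_ring_def by (rule cring_poly_ring)
  fix S T assume "?Z S" "?Z T"
  then obtain E F where E: "E \<subseteq> carrier ?R" "S = {P \<in> Gr n m q r. \<not> E \<subseteq> P}"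
    and F: "F \<subseteq> carrier ?R" "T = {P \<in> Gr n m q r. \<not> F \<subseteq> P}"
    unfolding zariski_open_def by blast
  let ?G = "{a \<otimes>\<^bsub>?R\<^esub> b | a b. a \<in> E \<and> b \<in> F}"
  have "S \<inter> T = {P \<in> Gr n m q r. \<not> ?G \<subseteq> P}" (is "_ = ?U")
  proof
    show "S \<inter> T \<subseteq> ?U"
    proof
      fix P assume P: "P \<in> S \<inter> T"
      then obtain a b where ab: "a \<in> E" "a \<notin> P" "b \<in> F" "b \<notin> P" using E F by blast
      have "primeideal P ?R" using P E by (auto simp: Gr_def)
      then have "a \<otimes>\<^bsub>?R\<^esub> b \<notin> P"
        using primeideal.I_prime[of P ?R a b] ab E(1) F(1) by blast
      then show "P \<in> ?U" using P E ab by blast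
    qed
    show "?U \<subseteq> S \<inter> T"
    proof
      fix P assume P: "P \<in> ?U"
      then obtain a b where ab: "a \<in> E" "b \<in> F" "a \<otimes>\<^bsub>?R\<^esub> b \<notin> P" by blast
      have "ideal P ?R" using P by (auto simp: Gr_def primeideal_def)
      then have "a \<notin> P" "b \<notin> P"
        using ab E(1) F(1) ideal.I_r_closed[of P ?R a b] ideal.I_l_closed[of P ?R b a] by blast+
      then show "P \<in> S \<inter> T" using P E F ab by blast
    qed
  qed
  moreover have "?G \<subseteq> carrier ?R" using E F by auto
  ultimately show "?Z (S \<inter> T)" unfolding zariski_open_def by blast
next
  let ?R = "pl_ring n m q r :: 'k pl_poly ring"
  let ?Z = "zariski_open n m q r :: 'k point set \<Rightarrow> bool"
  fix \<K> assume "\<forall>K\<in>\<K>. ?Z K"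
  then have "\<forall>K\<in>\<K>. \<exists>E. E \<subseteq> carrier ?R \<and> K = {P \<in> Gr n m q r. \<not> E \<subseteq> P}"
    unfolding zariski_open_def by blast
  from bchoice[OF this] obtain E where E:
    "\<forall>K\<in>\<K>. E K \<subseteq> carrier ?R \<and> K = {P \<in> Gr n m q r. \<not> E K \<subseteq> P}" ..
  have "P \<in> \<Union>\<K> \<longleftrightarrow> P \<in> {P \<in> Gr n m q r. \<not> \<Union>(E ` \<K>) \<subseteq> P}" for P
  proof -
    have "P \<in> K \<longleftrightarrow> P \<in> Gr n m q r \<and> \<not> E K \<subseteq> P" if "K \<in> \<K>" for K
      using E that by (metis (mono_tags, lifting) mem_Collect_eq)
    then show ?thesis by (auto simp: UN_subset_iff)
  qed
  then have "\<Union>\<K> = {P \<in> Gr n m q r. \<not> \<Union>(E ` \<K>) \<subseteq> P}"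
    by blast
  moreover have "\<Union>(E ` \<K>) \<subseteq> carrier ?R" using E by blast
  ultimately show "?Z (\<Union>\<K>)" unfolding zariski_open_def by blast
qed

lemma openin_Gr_top: "openin (Gr_top n m q r) = zariski_open n m q r"
  unfolding Gr_top_def by (rule topology_inverse'[OF istopology_zariski])

lemma topspace_Gr_top [simp]:
  "topspace (Gr_top n m q r) = (Gr n m q r :: 'k::field point set)"
proof
  let ?R = "pl_ring n m q r :: 'k pl_poly ring"
  have "\<not> carrier ?R \<subseteq> P" if "P \<in> Gr n m q r" for P
  proof -
    have "primeideal P ?R" using that by (auto simp: Gr_def)
    then interpret primeideal P ?R .
    show ?thesis using I_notcarr a_subset by blast
  qed
  then have "Gr n m q r = {P \<in> Gr n m q r. \<not> carrier ?R \<subseteq> P}" by blast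
  then have "zariski_open n m q r (Gr n m q r :: 'k point set)"
    unfolding zariski_open_def by blast
  then show "(Gr n m q r :: 'k point set) \<subseteq> topspace (Gr_top n m q r)"
    unfolding topspace_def openin_Gr_top by blast
  show "topspace (Gr_top n m q r) \<subseteq> (Gr n m q r :: 'k point set)"
    unfolding topspace_def openin_Gr_top zariski_open_def by blast
qed

definition closed_points :: "'a topology \<Rightarrow> 'a set \<Rightarrow> 'a set"
  where "closed_points X W = {P \<in> W. closedin X {P}}"

definition irreducible_subset :: "'a topology \<Rightarrow> 'a set \<Rightarrow> bool"
  where "irreducible_subset X W \<longleftrightarrow> W \<noteq> {} \<and> W \<subseteq> topspace X \<and>
    (\<forall>C D. closedin X C \<and> closedin X D \<and> W \<subseteq> C \<union> D \<longrightarrow> W \<subseteq> C \<or> W \<subseteq> D)"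

definition generic_point :: "'a topology \<Rightarrow> 'a set \<Rightarrow> 'a \<Rightarrow> bool"
  where "generic_point X W V \<longleftrightarrow> V \<in> W \<and> X closure_of {V} = W"

section \<open>The action of the general linear group\<close>

definition GL :: "nat \<Rightarrow> 'k::field mat set"
  where "GL N = {g \<in> carrier_mat N N. invertible_mat g}"

definition act :: "nat \<Rightarrow> 'k::field mat \<Rightarrow> (nat, 'k) mpoly \<Rightarrow> (nat, 'k) mpoly"
  where "act n g f = psubst (\<lambda>i. \<Sum>j\<le>n. Const (g $$ (i, j)) * Var j) f"

text \<open>
  The coefficient of \<open>L\<close> in \<open>g(L') = g(\<tau>'\<^sub>1) \<and> \<dots> \<and> g(\<tau>'\<^sub>q)\<close>, where \<open>L' = \<tau>'\<^sub>1 \<and> \<dots> \<and> \<tau>'\<^sub>q\<close>.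
\<close>

definition ext_act_coeff :: "nat \<Rightarrow> nat \<Rightarrow> 'k::field mat \<Rightarrow> ext_term \<Rightarrow> ext_term \<Rightarrow> 'k"
  where "ext_act_coeff n q g L L' =
    det (mat q q (\<lambda>(i, j). Poly_Mapping.lookup (act n g (Poly_Mapping.single (L' ! j) 1)) (L ! i)))"

text \<open>
  The pullback of functions along the automorphism \<open>V \<mapsto> g(V)\<close>: the Pluecker coordinates of \<open>g(V)\<close>
  are \<open>\<Delta>\<^sub>L(g(V)) = (\<Sum>L'. ext_act_coeff n q g L L' \<cdot> \<Delta>\<^sub>L\<^sub>'(V))\<close>. On prime ideals the automorphism
  is taking the inverse image under this pullback.
\<close>

definition pl_pullback ::
    "nat \<Rightarrow> nat \<Rightarrow> nat \<Rightarrow> nat monom rel \<Rightarrow> 'k::field mat \<Rightarrow> 'k pl_poly \<Rightarrow> 'k pl_poly"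
  where "pl_pullback n m q r g =
    psubst (\<lambda>L. \<Sum>L'\<in>ext_terms n m q r. Const (ext_act_coeff n q g L L') * Var L')"

definition act_point ::
    "nat \<Rightarrow> nat \<Rightarrow> nat \<Rightarrow> nat monom rel \<Rightarrow> 'k::field mat \<Rightarrow> 'k point \<Rightarrow> 'k point"
  where "act_point n m q r g P = {p \<in> carrier (pl_ring n m q r). pl_pullback n m q r g p \<in> P}"

definition orbit :: "nat \<Rightarrow> nat \<Rightarrow> nat \<Rightarrow> nat monom rel \<Rightarrow> 'k::field point set \<Rightarrow> 'k point set"
  where "orbit n m q r W = {act_point n m q r g V | g V. V \<in> W \<and> g \<in> GL (n + 1)}"

section \<open>Initial and generic initial extensors\<close>

definition U_chart ::
    "nat \<Rightarrow> nat \<Rightarrow> nat \<Rightarrow> nat monom rel \<Rightarrow> ext_term \<Rightarrow> 'k::field point set"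
  where "U_chart n m q r L = {P \<in> Gr n m q r. Var L \<notin> P}"

definition Delta_Supp ::
    "nat \<Rightarrow> nat \<Rightarrow> nat \<Rightarrow> nat monom rel \<Rightarrow> 'k::field point set \<Rightarrow> ext_term set"
  where "Delta_Supp n m q r W = {L \<in> ext_terms n m q r. U_chart n m q r L \<inter> W \<noteq> {}}"

definition max_ext :: "nat monom rel \<Rightarrow> ext_term set \<Rightarrow> ext_term"
  where "max_ext r A = (THE L. L \<in> A \<and> (\<forall>L'\<in>A. L' \<noteq> L \<longrightarrow> (L', L) \<in> lex r))"

definition in_ext :: "nat \<Rightarrow> nat \<Rightarrow> nat \<Rightarrow> nat monom rel \<Rightarrow> 'k::field point set \<Rightarrow> ext_term"
  where "in_ext n m q r W = max_ext r (Delta_Supp n m q r W)"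

definition gin_ext :: "nat \<Rightarrow> nat \<Rightarrow> nat \<Rightarrow> nat monom rel \<Rightarrow> 'k::field point set \<Rightarrow> ext_term"
  where "gin_ext n m q r W = max_ext r (Delta_Supp n m q r (orbit n m q r W))"

end

theory Submission
  imports
    Defs
    "Jordan_Normal_Form.Char_Poly"
    "HOL-Algebra.Algebraic_Closure_Type"
begin

text \<open>
  Both extensors of \<open>W\<close> are determined by the set of functions \<open>f\<close> (pullbacks of Pluecker
  coordinates) that lie outside some point of \<open>W\<close>: since \<open>f \<notin> V\<close> is an open condition on \<open>V\<close>, this
  set does not change under closure, which gives (i), and (iii) is the case of \<open>{V}\<close>. For (ii), a
  point \<open>V\<close> with \<open>f \<notin> V\<close> must specialise to a closed point not containing \<open>f\<close>. By the
  Nullstellensatz \<open>V\<close> vanishes at a point \<open>\<omega>\<close> over the algebraic closure at which \<open>f\<close> does not vanish;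
  the polynomials vanishing on the line through \<open>\<omega>\<close> form the required closed point. It is maximal
  because ratios of forms of equal degree have algebraic values at \<open>\<omega>\<close>.

  That \<open>GL\<close> acts on the Grassmannian means that pullbacks preserve the Pluecker ideal, which is the
  Cauchy-Binet formula.
\<close>

section \<open>Polynomials over subrings and prime ideals\<close>

text \<open>More than half of the proof is the Nullstellensatz, obtained by adjoining one variable
  at a time. The obstacle is that a homomorphism on \<open>A\<close> need not extend to
  \<open>A[x]\<close>: it may kill the leading coefficient of every equation of \<open>x\<close>.
  The induction therefore carries an arbitrary \<open>f\<close> outside \<open>P\<close>. To extend
  with a nonzero value of \<open>f\<close>, some \<open>a\<close> in \<open>A - P\<close> is fixed
  such that every \<phi> with \<phi>(a) \<noteq> 0 extends, and \<open>a\<close> takes the place of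
  \<open>f\<close> one variable earlier. Neither quotients nor fraction fields are formed: subrings
  and primes are sets in one ambient ring, degrees are read modulo a prime, and division is
  pseudo-division with multipliers outside it. Homomorphisms are total on the ambient ring; in the
  application they are evaluations at points whose remaining coordinates are arbitrary. On the
  Grassmannian, relevance (some Pluecker coordinate outside the prime) must survive each passage to
  another prime. A coordinate is carried along for this: the factor \<open>Var L0\<close> in the
  specialisation, and the \<open>L\<close> under study in the action of \<open>GL\<close>.\<close>

definition is_subring :: "'r::comm_ring_1 set \<Rightarrow> bool"
  where "is_subring A \<longleftrightarrow> 1 \<in> A \<and> (\<forall>x\<in>A. \<forall>y\<in>A. x - y \<in> A \<and> x * y \<in> A)"

lemma is_subring_simps:
  assumes "is_subring A"
  shows "1 \<in> A" "0 \<in> A" "x \<in> A \<Longrightarrow> y \<in> A \<Longrightarrow> x - y \<in> A" "x \<in> A \<Longrightarrow> y \<in> A \<Longrightarrow> x * y \<in> A"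
    "x \<in> A \<Longrightarrow> - x \<in> A" "x \<in> A \<Longrightarrow> y \<in> A \<Longrightarrow> x + y \<in> A" "x \<in> A \<Longrightarrow> x ^ k \<in> A"
proof -
  show one: "1 \<in> A" and diff: "x \<in> A \<Longrightarrow> y \<in> A \<Longrightarrow> x - y \<in> A"
    and mult: "x \<in> A \<Longrightarrow> y \<in> A \<Longrightarrow> x * y \<in> A" for x y
    using assms by (auto simp: is_subring_def)
  show zero: "0 \<in> A" using diff[OF one one] by simp
  show uminus: "x \<in> A \<Longrightarrow> - x \<in> A" for x using diff[OF zero, of x] by simp
  show "x \<in> A \<Longrightarrow> y \<in> A \<Longrightarrow> x + y \<in> A" using diff[OF _ uminus, of x y] by simp
  show "x \<in> A \<Longrightarrow> x ^ k \<in> A" by (induction k) (auto simp: one mult)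
qed

lemma is_subring_sum:
  assumes "is_subring A" "\<And>i. i \<in> I \<Longrightarrow> f i \<in> A"
  shows "sum f I \<in> A"
  using assms(2) by (induction I rule: infinite_finite_induct) (auto simp: is_subring_simps[OF assms(1)])

section \<open>Polynomials with coefficients in a subring\<close>

definition polys_over :: "'r::comm_ring_1 set \<Rightarrow> 'r poly set"
  where "polys_over A = {F. \<forall>i. poly.coeff F i \<in> A}"

lemma is_subring_polys_over:
  assumes "is_subring A" shows "is_subring (polys_over A)"
proof -
  note A = is_subring_simps[OF assms]
  have "poly.coeff (F * G) i \<in> A" if "F \<in> polys_over A" "G \<in> polys_over A" for F G i
    unfolding Polynomial.coeff_mult
    by (rule is_subring_sum[OF assms]) (use that in \<open>auto simp: polys_over_def A\<close>)
  then show ?thesis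
    unfolding is_subring_def by (auto simp: polys_over_def A)
qed

lemma monom_in_polys_over: "is_subring A \<Longrightarrow> a \<in> A \<Longrightarrow> Polynomial.monom a k \<in> polys_over A"
  by (auto simp: polys_over_def is_subring_simps)

lemma const_in_polys_over: "is_subring A \<Longrightarrow> a \<in> A \<Longrightarrow> [:a:] \<in> polys_over A"
  using monom_in_polys_over[of A a 0] by (simp add: monom_0)

lemma poly_in_subring:
  assumes "is_subring S" "A \<subseteq> S" "x \<in> S" "F \<in> polys_over A"
  shows "poly F x \<in> S"
  unfolding poly_altdef
  by (rule is_subring_sum[OF assms(1)])
    (use assms in \<open>auto simp: polys_over_def intro!: is_subring_simps\<close>)

text \<open>A set-based counterpart of \<open>primeideal\<close>: the ambient ring is a type of
  class \<open>comm_ring_1\<close>, so that \<open>'r poly\<close> and its evaluation apply to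
  subrings. For polynomial rings \<open>prime_in_iff_primeideal\<close> translates between the
  two.\<close>

locale prime_in =
  fixes S P :: "'r::comm_ring_1 set"
  assumes sub: "is_subring S" and P_sub: "P \<subseteq> S" and P_zero: "0 \<in> P" and P_one: "1 \<notin> P"
    and P_add: "\<And>x y. x \<in> P \<Longrightarrow> y \<in> P \<Longrightarrow> x + y \<in> P"
    and P_mult: "\<And>x y. x \<in> S \<Longrightarrow> y \<in> P \<Longrightarrow> x * y \<in> P"
    and P_prime: "\<And>x y. x \<in> S \<Longrightarrow> y \<in> S \<Longrightarrow> x * y \<in> P \<Longrightarrow> x \<in> P \<or> y \<in> P"
begin

lemmas S = is_subring_simps[OF sub]

lemma P_mult': "x \<in> P \<Longrightarrow> y \<in> S \<Longrightarrow> x * y \<in> P"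
  using P_mult[of y x] by (simp add: mult.commute)

lemma P_uminus: "x \<in> P \<Longrightarrow> - x \<in> P"
  using P_mult[of "- 1" x] S by simp

lemma P_diff: "x \<in> P \<Longrightarrow> y \<in> P \<Longrightarrow> x - y \<in> P"
  using P_add[OF _ P_uminus, of x y] by simp

lemma P_sum: "(\<And>i. i \<in> I \<Longrightarrow> f i \<in> P) \<Longrightarrow> sum f I \<in> P"
  by (induction I rule: infinite_finite_induct) (auto simp: P_zero P_add)

lemma P_diffD: "x - y \<in> P \<Longrightarrow> y \<in> P \<Longrightarrow> x \<in> P"
  using P_add[of "x - y" y] by simp

lemma P_diffD': "x - y \<in> P \<Longrightarrow> x \<in> P \<Longrightarrow> y \<in> P"
  using P_diff[of x "x - y"] by simp

lemma P_power: "x \<in> S \<Longrightarrow> x ^ k \<in> P \<Longrightarrow> x \<in> P"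
proof (induction k)
  case (Suc k)
  then show ?case using P_prime[of x "x ^ k"] S by auto
qed (use P_one in auto)

text \<open>\<open>d\<close> is the degree of the reduction of \<open>F\<close> modulo \<open>P\<close>.\<close>

definition top_degree :: "'r poly \<Rightarrow> nat \<Rightarrow> bool"
  where "top_degree F d \<longleftrightarrow> poly.coeff F d \<notin> P \<and> (\<forall>i>d. poly.coeff F i \<in> P)"

lemma ex_top:
  assumes "poly.coeff F i \<notin> P"
  obtains d where "top_degree F d"
proof -
  have fin: "finite {i. poly.coeff F i \<notin> P}"
    by (rule finite_subset[of _ "{..Polynomial.degree F}"])
      (use P_zero in \<open>auto intro: le_degree\<close>)
  define d where "d = Max {i. poly.coeff F i \<notin> P}"
  have "d \<in> {i. poly.coeff F i \<notin> P}"
    unfolding d_def by (rule Max_in[OF fin]) (use assms in auto)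
  moreover have "poly.coeff F i \<in> P" if "i > d" for i
    using that Max_ge[OF fin, of i] unfolding d_def by force
  ultimately show ?thesis using that unfolding top_degree_def by blast
qed

lemma top_unique: "top_degree F d \<Longrightarrow> top_degree F e \<Longrightarrow> d = e"
  unfolding top_degree_def by (metis linorder_neqE_nat)

lemma top_cong:
  assumes "\<And>i. poly.coeff (F - G) i \<in> P" "top_degree F d"
  shows "top_degree G d"
  using assms P_diffD P_diffD' unfolding top_degree_def coeff_diff by metis

lemma top_mult:
  assumes F: "F \<in> polys_over S" "top_degree F d" and G: "G \<in> polys_over S" "top_degree G e"
  shows "top_degree (F * G) (d + e)"
proof -
  have c: "poly.coeff F i \<in> S" "poly.coeff G i \<in> S" for i
    using F G by (auto simp: polys_over_def)
  have "poly.coeff F i * poly.coeff G j \<in> P" if "i + j \<ge> d + e" "i \<noteq> d \<or> j \<noteq> e" for i j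
  proof (cases "i > d")
    case True then show ?thesis using F c P_mult' by (auto simp: top_degree_def)
  next
    case False then have "j > e" using that by auto
    then show ?thesis using G c P_mult by (auto simp: top_degree_def)
  qed note * = this
  have "poly.coeff (F * G) k \<in> P" if "k > d + e" for k
    unfolding Polynomial.coeff_mult by (rule P_sum, rule *) (use that in auto)
  moreover have "poly.coeff (F * G) (d + e) \<notin> P"
  proof
    have "poly.coeff (F * G) (d + e) = poly.coeff F d * poly.coeff G e +
        (\<Sum>i\<in>{..d + e} - {d}. poly.coeff F i * poly.coeff G (d + e - i))"
      unfolding Polynomial.coeff_mult by (subst sum.remove[of _ d]) auto
    moreover have "(\<Sum>i\<in>{..d + e} - {d}. poly.coeff F i * poly.coeff G (d + e - i)) \<in> P"
      by (rule P_sum) (use * in auto)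
    moreover assume "poly.coeff (F * G) (d + e) \<in> P"
    ultimately have "poly.coeff F d * poly.coeff G e \<in> P"
      by (metis P_diff add_diff_cancel_right')
    then show False using P_prime F G c by (auto simp: top_degree_def)
  qed
  ultimately show ?thesis by (auto simp: top_degree_def)
qed

lemma smult_in_polys_over: "a \<in> S \<Longrightarrow> F \<in> polys_over S \<Longrightarrow> Polynomial.smult a F \<in> polys_over S"
  by (auto simp: polys_over_def S)

text \<open>Over the fraction field of \<open>S\<close> modulo \<open>P\<close>, the ideal generated
  by \<open>M\<close> is principal, generated by an element of least degree; clearing denominators
  leaves the multiplier \<open>c\<close>. Used modulo \<open>P \<inter> A\<close> for equations of
  \<open>x\<close>, and modulo the kernel of a homomorphism in \<open>extend_hom\<close>.\<close>

lemma pseudo_division: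
  assumes M: "M \<subseteq> polys_over S" "\<And>F G. F \<in> M \<Longrightarrow> G \<in> M \<Longrightarrow> F - G \<in> M"
    "\<And>U F. U \<in> polys_over S \<Longrightarrow> F \<in> M \<Longrightarrow> U * F \<in> M"
  and H: "H \<in> M" "top_degree H e" and least: "\<And>F d. F \<in> M \<Longrightarrow> top_degree F d \<Longrightarrow> e \<le> d"
  and F: "F \<in> M"
  shows "\<exists>c\<in>S - P. \<exists>U\<in>polys_over S. \<forall>i. poly.coeff (Polynomial.smult c F - U * H) i \<in> P"
proof -
  note PS = is_subring_simps[OF is_subring_polys_over[OF sub]]
  have "\<exists>c\<in>S - P. \<exists>U\<in>polys_over S. \<forall>i. poly.coeff (Polynomial.smult c F - U * H) i \<in> P"
    if "F \<in> M" "\<And>i. i \<ge> N \<Longrightarrow> poly.coeff F i \<in> P" for F N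
    using that
  proof (induction N arbitrary: F)
    case 0
    then show ?case using S P_one PS by (intro bexI[of _ 1] bexI[of _ 0]) auto
  next
    case (Suc N)
    show ?case
    proof (cases "N < e")
      case True
      have "poly.coeff F i \<in> P" for i
      proof (rule ccontr)
        assume "poly.coeff F i \<notin> P"
        then obtain d where d: "top_degree F d" by (rule ex_top)
        then have "d < Suc N" using Suc.prems(2)[of d] by (auto simp: top_degree_def not_le[symmetric])
        then show False using least[OF Suc.prems(1) d] True by simp
      qed
      then show ?thesis using S P_one PS by (intro bexI[of _ 1] bexI[of _ 0]) auto
    next
      case False
      \<comment> \<open>Cancelling the term of degree \<open>N\<close> without dividing:
        \<open>F\<close> is multiplied by \<open>h\<close>, which lies outside \<open>P\<close>. The
        coefficient at \<open>N\<close> becomes 0, those above stay in \<open>P\<close>, and the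
        factors \<open>h\<close> accumulate in \<open>c\<close>.\<close>
      define h where "h = poly.coeff H e"
      define m where "m = Polynomial.monom (poly.coeff F N) (N - e)"
      define F' where "F' = Polynomial.smult h F - m * H"
      have H': "poly.coeff H i \<in> S" and F': "poly.coeff F i \<in> S" for i
        using M(1) H(1) Suc.prems(1) by (auto simp: polys_over_def)
      have h: "h \<in> S" "h \<notin> P" using H H' by (auto simp: h_def top_degree_def)
      have m: "m \<in> polys_over S" unfolding m_def using monom_in_polys_over[OF sub F'] .
      have "F' \<in> M"
        using M(2)[OF M(3)[OF const_in_polys_over[OF sub h(1)] Suc.prems(1)] M(3)[OF m H(1)]]
        by (simp add: F'_def)
      moreover have "poly.coeff F' i \<in> P" if "i \<ge> N" for i
      proof (cases "i = N")
        case True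
        then show ?thesis using False P_zero
          by (simp add: F'_def m_def h_def coeff_monom_mult)
      next
        case i: False
        then have "poly.coeff F i \<in> P" using Suc.prems(2) that by simp
        moreover have "poly.coeff H (i - (N - e)) \<in> P"
          using H(2) that i False by (auto simp: top_degree_def)
        ultimately show ?thesis using that False h F'
          by (auto simp: F'_def m_def coeff_monom_mult intro!: P_diff P_mult)
      qed
      ultimately obtain c U where cU: "c \<in> S - P" "U \<in> polys_over S"
        "\<And>i. poly.coeff (Polynomial.smult c F' - U * H) i \<in> P"
        using Suc.IH by blast
      have eq: "Polynomial.smult c F' - U * H =
          Polynomial.smult (c * h) F - (U + Polynomial.smult c m) * H"
        by (simp add: F'_def algebra_simps smult_diff_right)
      have "c * h \<in> S - P" using cU(1) h S P_prime[of c h] by auto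
      moreover have "U + Polynomial.smult c m \<in> polys_over S"
        using cU m PS smult_in_polys_over by auto
      ultimately show ?thesis using cU(3) unfolding eq by blast
    qed
  qed
  from this[of F "Suc (Polynomial.degree F)"] F show ?thesis
    using P_zero by (auto simp: coeff_eq_0 Suc_le_eq)
qed

lemma poly_coeffs_in_P:
  assumes "x \<in> S" "\<And>i. poly.coeff F i \<in> P" shows "poly F x \<in> P"
  unfolding poly_altdef by (rule P_sum) (use assms S in \<open>auto intro!: P_mult'\<close>)

text \<open>Values at \<open>x\<close> lie in \<open>S\<close> but coefficients lie in
  \<open>A\<close>, so degrees of polynomials over \<open>A\<close> are taken modulo
  \<open>P \<inter> A\<close>.\<close>

lemma prime_in_restrict:
  assumes "is_subring A" "A \<subseteq> S"
  shows "prime_in A (P \<inter> A)"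
proof -
  note A = is_subring_simps[OF assms(1)]
  show ?thesis
  proof
    fix x y assume "x \<in> A" "y \<in> A" "x * y \<in> P \<inter> A"
    then show "x \<in> P \<inter> A \<or> y \<in> P \<inter> A" using P_prime[of x y] assms(2) by auto
  qed (use assms P_zero P_one P_add P_mult A in auto)
qed

text \<open>Among the polynomials whose value at \<open>x\<close> is divisible by that of \<open>G\<close>, one of least degree is
  constant, since otherwise it would properly divide the minimal polynomial of \<open>x\<close>.\<close>

lemma divides_nonzero_of_algebraic:
  assumes A: "is_subring A" "A \<subseteq> S" and x: "x \<in> S"
    and F: "F \<in> polys_over A" "poly F x \<in> P" "poly.coeff F i \<notin> P"
    and G: "G \<in> polys_over A" "poly G x \<notin> P"
  shows "\<exists>a\<in>A - P. \<exists>U\<in>polys_over A. a - poly U x * poly G x \<in> P"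
proof -
  interpret A: prime_in A "P \<inter> A" by (rule prime_in_restrict[OF A])
  note PA = is_subring_simps[OF is_subring_polys_over[OF A(1)]]
  have ev: "poly U x \<in> S" if "U \<in> polys_over A" for U
    using poly_in_subring[OF sub A(2) x that] .
  have coeffA: "poly.coeff U j \<in> A" if "U \<in> polys_over A" for U j
    using that by (auto simp: polys_over_def)
  \<comment> \<open>\<open>N\<close> consists of the equations of \<open>x\<close> modulo
    \<open>P\<close>; \<open>M\<close> is the preimage of the ideal that the value of
    \<open>G\<close> generates in \<open>A[x]\<close> modulo \<open>P\<close>. It contains both
    \<open>N\<close> and \<open>G\<close>.\<close>
  define N where "N = {F \<in> polys_over A. poly F x \<in> P}"
  define M where "M = {H \<in> polys_over A. \<exists>U\<in>polys_over A. poly H x - poly U x * poly G x \<in> P}"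
  have NM: "N \<subseteq> M" unfolding N_def M_def using PA by (auto intro!: bexI[of _ 0])
  have GM: "G \<in> M" unfolding M_def using G PA P_zero by (auto intro!: bexI[of _ 1])
  have M: "M \<subseteq> polys_over A" "\<And>F G. F \<in> M \<Longrightarrow> G \<in> M \<Longrightarrow> F - G \<in> M"
    "\<And>U F. U \<in> polys_over A \<Longrightarrow> F \<in> M \<Longrightarrow> U * F \<in> M"
  proof -
    show "M \<subseteq> polys_over A" by (auto simp: M_def)
    fix F H assume F: "F \<in> M"
    then obtain U where U: "U \<in> polys_over A" "poly F x - poly U x * poly G x \<in> P" "F \<in> polys_over A"
      by (auto simp: M_def)
    show "V * F \<in> M" if V: "V \<in> polys_over A" for V
    proof -
      have "poly V x * (poly F x - poly U x * poly G x) \<in> P" using P_mult ev V U by blast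
      then have "poly (V * F) x - poly (V * U) x * poly G x \<in> P" by (simp add: algebra_simps)
      then show ?thesis using U V PA unfolding M_def by blast
    qed
    show "F - H \<in> M" if H: "H \<in> M"
    proof -
      obtain V where V: "V \<in> polys_over A" "poly H x - poly V x * poly G x \<in> P" "H \<in> polys_over A"
        using H by (auto simp: M_def)
      have "(poly F x - poly U x * poly G x) - (poly H x - poly V x * poly G x) \<in> P"
        using P_diff U V by blast
      then have "poly (F - H) x - poly (U - V) x * poly G x \<in> P" by (simp add: algebra_simps)
      then show ?thesis using U V PA unfolding M_def by blast
    qed
  qed
  have "poly.coeff F i \<notin> P \<inter> A" using F by auto
  then obtain d0 where d0: "A.top_degree F d0" by (rule A.ex_top)
  have FN: "F \<in> N" using F by (auto simp: N_def)
  define d where "d = (LEAST d. \<exists>F\<in>N. A.top_degree F d)"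
  have "\<exists>F\<in>N. A.top_degree F d" unfolding d_def by (rule LeastI[of _ d0]) (use FN d0 in blast)
  then obtain F1 where F1: "F1 \<in> N" "A.top_degree F1 d" by blast
  have d_least: "d \<le> k" if "F \<in> N" "A.top_degree F k" for F k
    unfolding d_def by (rule Least_le) (use that in blast)
  define e where "e = (LEAST d. \<exists>F\<in>M. A.top_degree F d)"
  have "\<exists>F\<in>M. A.top_degree F e" unfolding e_def by (rule LeastI[of _ d0]) (use FN NM d0 in blast)
  then obtain H where H: "H \<in> M" "A.top_degree H e" by blast
  have e_least: "e \<le> k" if "F \<in> M" "A.top_degree F k" for F k
    unfolding e_def by (rule Least_le) (use that in blast)
  have HA: "H \<in> polys_over A" using H M by blast
  have ediv: "\<exists>c\<in>A - P. \<exists>U\<in>polys_over A. (\<forall>i. poly.coeff (Polynomial.smult c F - U * H) i \<in> P \<inter> A) \<and>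
      c * poly F x - poly U x * poly H x \<in> P" if FM: "F \<in> M" for F
  proof -
    have "\<exists>c\<in>A - P \<inter> A. \<exists>U\<in>polys_over A.
        \<forall>i. poly.coeff (Polynomial.smult c F - U * H) i \<in> P \<inter> A"
      by (rule A.pseudo_division[of M, OF _ _ _ H _ FM]) (use M e_least in blast)+
    then obtain c U where cU: "c \<in> A - P \<inter> A" "U \<in> polys_over A"
      "\<And>i. poly.coeff (Polynomial.smult c F - U * H) i \<in> P \<inter> A"
      by blast
    moreover have "poly (Polynomial.smult c F - U * H) x \<in> P"
      by (rule poly_coeffs_in_P[OF x]) (use cU in blast)
    ultimately show ?thesis by auto
  qed
  show ?thesis
  proof (cases "e = 0")
    case True
    obtain U where U: "U \<in> polys_over A" "poly H x - poly U x * poly G x \<in> P"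
      using H by (auto simp: M_def)
    \<comment> \<open>In degree 0, \<open>H\<close> agrees modulo \<open>P\<close> with its constant
      coefficient, which is the required \<open>a\<close>.\<close>
    have "poly.coeff (H - [:poly.coeff H 0:]) i \<in> P" for i
      using H(2) True P_zero by (auto simp: A.top_degree_def coeff_pCons split: nat.splits)
    then have "poly (H - [:poly.coeff H 0:]) x \<in> P" by (rule poly_coeffs_in_P[OF x])
    then have "poly H x - poly.coeff H 0 \<in> P" by simp
    from P_diff[OF U(2) this] have "poly.coeff H 0 - poly U x * poly G x \<in> P" by simp
    moreover have "poly.coeff H 0 \<in> A - P"
      using H(2) True coeffA[OF HA] by (auto simp: A.top_degree_def)
    ultimately show ?thesis using U by blast
  next
    case False
    obtain c U where cU: "c \<in> A - P" "U \<in> polys_over A"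
      "\<And>i. poly.coeff (Polynomial.smult c F1 - U * H) i \<in> P \<inter> A"
      "c * poly F1 x - poly U x * poly H x \<in> P"
      using ediv[of F1] F1 NM by blast
    have "A.top_degree (Polynomial.smult c F1) d"
    proof -
      have "F1 \<in> polys_over A" using F1 by (auto simp: N_def)
      then show ?thesis using F1(2) cU(1) A.P_mult A.P_prime[of c "poly.coeff F1 d"] coeffA[of F1]
        by (auto simp: A.top_degree_def)
    qed
    from A.top_cong[OF cU(3) this] have dt: "A.top_degree (U * H) d" .
    have "\<exists>k. A.top_degree U k"
    proof (rule ccontr)
      assume "\<nexists>k. A.top_degree U k"
      then have "poly.coeff U j \<in> P \<inter> A" for j using A.ex_top by blast
      then have "poly.coeff (U * H) d \<in> P \<inter> A"
        unfolding Polynomial.coeff_mult by (intro A.P_sum A.P_mult') (use HA coeffA in auto)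
      then show False using dt by (auto simp: A.top_degree_def)
    qed
    then obtain k where k: "A.top_degree U k" by blast
    from A.top_unique[OF dt A.top_mult[OF cU(2) k HA H(2)]] have "d = k + e" .
    \<comment> \<open>\<open>e > 0\<close> makes \<open>k\<close> smaller than \<open>d\<close>, the
      least degree of an equation of \<open>x\<close>.\<close>
    then have "U \<notin> N" using d_least[OF _ k] False by fastforce
    then have "poly U x \<notin> P" using cU by (auto simp: N_def)
    moreover have "poly U x * poly H x \<in> P"
      using P_diffD'[OF cU(4)] F1 cU A P_mult by (auto simp: N_def)
    ultimately have hP: "poly H x \<in> P" using P_prime ev cU HA by blast
    \<comment> \<open>With the value of \<open>H\<close> in \<open>P\<close>, division of
      \<open>G\<close> by \<open>H\<close> forces the value of \<open>G\<close> into
      \<open>P\<close>, contrary to the hypothesis.\<close>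
    obtain c V where cV: "c \<in> A - P" "V \<in> polys_over A" "c * poly G x - poly V x * poly H x \<in> P"
      using ediv[OF GM] by blast
    have "c * poly G x \<in> P" using P_diffD[OF cV(3)] P_mult hP ev cV by blast
    then have "poly G x \<in> P" using P_prime cV A ev[OF G(1)] by blast
    then show ?thesis using G by simp
  qed
qed

end

section \<open>Extension of homomorphisms from \<open>A\<close> to \<open>A[x]\<close>\<close>

lemma prime_in_kernel:
  fixes \<phi> :: "'r::comm_ring_1 \<Rightarrow> 'w::idom"
  assumes "comm_ring_hom \<phi>" "is_subring A"
  shows "prime_in A {a \<in> A. \<phi> a = 0}"
proof -
  interpret comm_ring_hom \<phi> by fact
  show ?thesis
    by standard (use is_subring_simps[OF assms(2)] in \<open>auto simp: hom_distribs assms\<close>)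
qed

context prime_in
begin

text \<open>An equation of \<open>x\<close> may have coefficients in \<open>P\<close> above its
  degree modulo \<open>P\<close>. Since \<open>extend_hom\<close> looks at the actual leading
  coefficient, these are cut off first.\<close>

lemma truncate:
  assumes A: "is_subring A" "A \<subseteq> S" and x: "x \<in> S"
    and F: "F \<in> polys_over A" "poly F x \<in> P" "top_degree F d"
  obtains F' where "F' \<in> polys_over A" "poly F' x \<in> P" "Polynomial.degree F' = d"
    "poly.coeff F' d = poly.coeff F d"
proof
  define F' where "F' = poly_cutoff (Suc d) F"
  show "F' \<in> polys_over A"
    using F(1) is_subring_simps(2)[OF A(1)] by (auto simp: F'_def polys_over_def coeff_poly_cutoff)
  have "poly.coeff (F - F') i \<in> P" for i
    using F(3) P_zero by (auto simp: F'_def coeff_poly_cutoff top_degree_def)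
  then have "poly (F - F') x \<in> P" by (rule poly_coeffs_in_P[OF x])
  then show "poly F' x \<in> P" using P_diffD' F(2) by simp
  show *: "poly.coeff F' d = poly.coeff F d" by (simp add: F'_def coeff_poly_cutoff)
  show "Polynomial.degree F' = d"
  proof (rule antisym)
    show "Polynomial.degree F' \<le> d"
      by (rule degree_le) (simp add: F'_def coeff_poly_cutoff)
    have "poly.coeff F d \<noteq> 0" using F(3) P_zero by (auto simp: top_degree_def)
    then show "d \<le> Polynomial.degree F'" using * by (intro le_degree) simp
  qed
qed

text \<open>The step from \<open>A\<close> to \<open>A[x]\<close> in the lying-over theorem: reducing \<open>F\<close> and \<open>G\<close> against
  each other lowers the sum of their degrees and keeps the leading coefficient of \<open>F\<close> and the
  constant coefficient of \<open>G\<close> outside the kernel of \<open>\<phi>\<close>.\<close>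

lemma lying_over:
  fixes \<phi> :: "'r \<Rightarrow> 'w::idom"
  assumes A: "is_subring A" "A \<subseteq> S" and x: "x \<in> S"
    and hom: "comm_ring_hom \<phi>" and ker: "\<And>a. a \<in> P \<inter> A \<Longrightarrow> \<phi> a = 0"
  shows "F \<in> polys_over A \<Longrightarrow> poly F x \<in> P \<Longrightarrow> \<phi> (poly.coeff F (Polynomial.degree F)) \<noteq> 0 \<Longrightarrow>
    G \<in> polys_over A \<Longrightarrow> poly G x \<in> P \<Longrightarrow> \<phi> (poly.coeff G 0) \<noteq> 0 \<Longrightarrow>
    (\<And>i. i > 0 \<Longrightarrow> \<phi> (poly.coeff G i) = 0) \<Longrightarrow> False"
proof (induction "Polynomial.degree F + Polynomial.degree G" arbitrary: F G rule: less_induct)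
  case less
  interpret comm_ring_hom \<phi> by fact
  define d e where "d = Polynomial.degree F" and "e = Polynomial.degree G"
  define f g where "f = poly.coeff F" and "g = poly.coeff G"
  have fg: "f i \<in> A" "g i \<in> A" for i using less.prems by (auto simp: f_def g_def polys_over_def)
  note A' = is_subring_simps[OF A(1)]
  note PA = is_subring_simps[OF is_subring_polys_over[OF A(1)]]
  have ev: "poly U x \<in> S" if "U \<in> polys_over A" for U
    using poly_in_subring[OF sub A(2) x that] .
  have smult: "Polynomial.smult a U \<in> polys_over A" if "a \<in> A" "U \<in> polys_over A" for a U
    using that A' by (auto simp: polys_over_def)
  have smultP: "poly (Polynomial.smult a U) x \<in> P" if "a \<in> A" "poly U x \<in> P" for a U
    using that A P_mult by auto
  \<comment> \<open>A constant \<open>G\<close>, and likewise a constant \<open>F\<close>, would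
    itself lie in \<open>P \<inter> A\<close> and be killed by \<phi>.\<close>
  have "e > 0"
  proof (rule ccontr)
    assume "\<not> e > 0"
    then obtain c where "G = [:c:]" unfolding e_def using degree_eq_zeroE by blast
    then have "g 0 \<in> P \<inter> A" using less.prems fg(2)[of 0] by (simp add: g_def)
    then show False using ker less.prems by (simp add: g_def)
  qed
  have "d > 0"
  proof (rule ccontr)
    assume d: "\<not> d > 0"
    then obtain c where "F = [:c:]" unfolding d_def using degree_eq_zeroE by blast
    then have "f 0 \<in> P \<inter> A" using less.prems fg(1)[of 0] by (simp add: f_def)
    then show False using ker less.prems d by (simp add: f_def d_def)
  qed
  \<comment> \<open>If \<open>x\<close> were in \<open>P\<close>, so would be the constant
    coefficient of \<open>G\<close>, which \<phi> does not kill.\<close>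
  have xP: "x \<notin> P"
  proof
    assume "x \<in> P"
    obtain c U where G: "G = pCons c U" by (rule pCons_cases)
    have "poly.coeff U j = g (Suc j)" for j by (simp add: g_def G)
    then have "U \<in> polys_over A" using fg(2) by (simp add: polys_over_def)
    then have "x * poly U x \<in> P" by (rule P_mult'[OF \<open>x \<in> P\<close> ev])
    moreover have "c + x * poly U x \<in> P" using less.prems G by simp
    ultimately have "c \<in> P" using P_diff by fastforce
    then show False using ker[of c] fg(2)[of 0] less.prems by (simp add: g_def G)
  qed
  show False
  proof (cases "d \<le> e")
    case True
    define m where "m = Polynomial.monom (g e) (e - d)"
    \<comment> \<open>The terms of degree \<open>e\<close> cancel. Since \<phi> kills
      \<open>g e\<close>, the image of \<open>G'\<close> is that of \<open>G\<close> times \<phi>(f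
      d) \<noteq> 0, again a nonzero constant.\<close>
    define G' where "G' = Polynomial.smult (f d) G - m * F"
    have m: "m \<in> polys_over A" unfolding m_def using monom_in_polys_over[OF A(1) fg(2)] .
    have coeff: "poly.coeff G' i = f d * g i - (if e - d \<le> i then g e * f (i - (e - d)) else 0)" for i
      by (simp add: G'_def m_def coeff_monom_mult f_def g_def)
    have ge: "\<phi> (g e) = 0" using less.prems(7)[OF \<open>e > 0\<close>] by (simp add: g_def)
    have "Polynomial.degree G' < e"
    proof (rule degree_lessI)
      show "\<forall>k\<ge>e. poly.coeff G' k = 0"
      proof (intro allI impI)
        fix k assume k: "k \<ge> e"
        show "poly.coeff G' k = 0"
        proof (cases "k = e")
          case True
          then show ?thesis using \<open>d \<le> e\<close> by (simp add: coeff mult.commute)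
        next
          case False
          then have "g k = 0" "f (k - (e - d)) = 0"
            using k \<open>d \<le> e\<close> by (auto simp: f_def g_def d_def e_def intro!: coeff_eq_0)
          then show ?thesis by (simp add: coeff)
        qed
      qed
    qed (use \<open>e > 0\<close> in auto)
    moreover have "G' \<in> polys_over A" unfolding G'_def
      by (rule PA(3)[OF smult[OF fg(1) less.prems(4)] PA(4)[OF m less.prems(1)]])
    moreover have "poly G' x \<in> P"
    proof -
      have "poly m x * poly F x \<in> P" by (rule P_mult[OF ev[OF m] less.prems(2)])
      then show ?thesis unfolding G'_def poly_diff poly_mult
        by (rule P_diff[OF smultP[OF fg(1) less.prems(5)]])
    qed
    moreover have "\<phi> (poly.coeff G' i) = \<phi> (f d) * \<phi> (g i)" for i
      unfolding coeff by (simp add: hom_distribs ge)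
    ultimately show False
      using less.hyps[of F G'] less.prems(1-3,6,7) by (simp add: f_def g_def d_def e_def)
  next
    case False
    \<comment> \<open>The constant terms cancel, so the combination is \<open>X\<close> times
      \<open>U\<close>, and \<open>x\<close> outside \<open>P\<close> allows \<open>X\<close> to be
      dropped. As \<open>e < d\<close>, the leading coefficient of \<open>U\<close>, in degree
      \<open>d - 1\<close>, is \<open>g 0 * f d\<close>.\<close>
    obtain c U where U: "Polynomial.smult (g 0) F - Polynomial.smult (f 0) G = pCons c U"
      by (rule pCons_cases)
    have coeff: "poly.coeff (pCons c U) i = g 0 * f i - f 0 * g i" for i
      by (simp add: U[symmetric] f_def g_def)
    have "c = 0" using coeff[of 0] by simp
    have Ui: "poly.coeff U i = g 0 * f (Suc i) - f 0 * g (Suc i)" for i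
      using coeff[of "Suc i"] by simp
    have UA: "U \<in> polys_over A" using fg A' by (auto simp: polys_over_def Ui)
    have "poly (pCons c U) x \<in> P" unfolding U[symmetric] poly_diff
      by (intro P_diff smultP fg less.prems(2,5))
    then have UP: "poly U x \<in> P" using \<open>c = 0\<close> xP P_prime x ev[OF UA] by auto
    have gz: "g i = 0" if "i \<ge> d" for i
      using that False by (auto simp: g_def e_def intro!: coeff_eq_0)
    have fz: "f i = 0" if "i > d" for i
      using that by (auto simp: f_def d_def intro!: coeff_eq_0)
    have lc: "poly.coeff U (d - 1) = g 0 * f d" using \<open>d > 0\<close> gz by (simp add: Ui)
    have lcnz: "\<phi> (g 0 * f d) \<noteq> 0"
      using less.prems by (simp add: hom_distribs f_def g_def d_def)
    have "Polynomial.degree U = d - 1"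
    proof (rule antisym)
      show "Polynomial.degree U \<le> d - 1"
        using \<open>d > 0\<close> by (intro degree_le) (auto simp: Ui gz fz)
      show "d - 1 \<le> Polynomial.degree U"
        by (rule le_degree) (use lc lcnz in auto)
    qed
    then show False
      using less.hyps[of U G] less.prems UA UP lc lcnz \<open>d > 0\<close> by (simp add: d_def)
  qed
qed

text \<open>The value \<xi> must be a common root of the \<phi>-images of all equations of
  \<open>x\<close>. One equation \<open>T\<close>, of least degree after applying \<phi>, divides
  the others up to factors that \<phi> does not kill, so a root for \<open>T\<close> suffices. The
  condition on \<open>F\<close> makes \<open>x\<close> integral over a localisation of
  \<open>A\<close> to which \<phi> extends.\<close>

lemma extend_hom:
  fixes \<phi> :: "'r \<Rightarrow> 'w::alg_closed_field"
  assumes A: "is_subring A" "A \<subseteq> S" and x: "x \<in> S"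
    and hom: "comm_ring_hom \<phi>" and ker: "\<And>a. a \<in> P \<inter> A \<Longrightarrow> \<phi> a = 0"
    and F: "F \<in> polys_over A" "poly F x \<in> P" "\<phi> (poly.coeff F (Polynomial.degree F)) \<noteq> 0"
  shows "\<exists>\<xi>. \<forall>G\<in>polys_over A. poly G x \<in> P \<longrightarrow> poly (map_poly \<phi> G) \<xi> = 0"
proof -
  interpret \<phi>: comm_ring_hom \<phi> by fact
  interpret \<phi>p: map_poly_comm_ring_hom \<phi> ..
  interpret K: prime_in A "{a \<in> A. \<phi> a = 0}" by (rule prime_in_kernel[OF hom A(1)])
  note PA = is_subring_simps[OF is_subring_polys_over[OF A(1)]]
  define N where "N = {F \<in> polys_over A. poly F x \<in> P}"
  have N: "N \<subseteq> polys_over A" "\<And>F G. F \<in> N \<Longrightarrow> G \<in> N \<Longrightarrow> F - G \<in> N"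
    "\<And>U F. U \<in> polys_over A \<Longrightarrow> F \<in> N \<Longrightarrow> U * F \<in> N"
    using PA P_diff P_mult poly_in_subring[OF sub A(2) x] by (auto simp: N_def)
  have FN: "F \<in> N" using F by (simp add: N_def)
  obtain d0 where d0: "K.top_degree F d0" by (rule K.ex_top[of F "Polynomial.degree F"]) (use F in auto)
  define e where "e = (LEAST d. \<exists>F\<in>N. K.top_degree F d)"
  have "\<exists>F\<in>N. K.top_degree F e" unfolding e_def by (rule LeastI[of _ d0]) (use FN d0 in blast)
  then obtain T where T: "T \<in> N" "K.top_degree T e" by blast
  have e_least: "e \<le> k" if "F \<in> N" "K.top_degree F k" for F k
    unfolding e_def by (rule Least_le) (use that in blast)
  have TA: "poly.coeff T i \<in> A" for i using T N by (auto simp: polys_over_def)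
  \<comment> \<open>Degree 0 would mean that \<phi> sends \<open>T\<close> to a nonzero constant,
    which has no root; \<open>lying_over\<close> with \<open>T\<close> as its \<open>G\<close>
    excludes this.\<close>
  have "e > 0"
  proof (rule ccontr)
    assume "\<not> e > 0"
    then have "\<phi> (poly.coeff T 0) \<noteq> 0" "\<And>i. i > 0 \<Longrightarrow> \<phi> (poly.coeff T i) = 0"
      using T(2) TA by (auto simp: K.top_degree_def)
    then show False
      using lying_over[OF A x hom ker F] T by (auto simp: N_def)
  qed
  moreover have "poly.coeff (map_poly \<phi> T) e \<noteq> 0"
    using T(2) TA by (auto simp: K.top_degree_def)
  ultimately have "Polynomial.degree (map_poly \<phi> T) > 0"
    using le_degree by fastforce
  then obtain \<xi> where \<xi>: "poly (map_poly \<phi> T) \<xi> = 0" using alg_closed_imp_poly_has_root by blast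
  have "poly (map_poly \<phi> G) \<xi> = 0" if "G \<in> polys_over A" "poly G x \<in> P" for G
  proof -
    have GN: "G \<in> N" using that by (simp add: N_def)
    \<comment> \<open>Division modulo the kernel of \<phi>: the remainder vanishes after applying
      \<phi>, and \<phi>(c) can be cancelled.\<close>
    have "\<exists>c\<in>A - {a \<in> A. \<phi> a = 0}. \<exists>U\<in>polys_over A.
        \<forall>i. poly.coeff (Polynomial.smult c G - U * T) i \<in> {a \<in> A. \<phi> a = 0}"
      by (rule K.pseudo_division[of N, OF _ _ _ T _ GN]) (use N e_least in blast)+
    then obtain c U where cU: "c \<in> A - {a \<in> A. \<phi> a = 0}" "U \<in> polys_over A"
      "\<And>i. poly.coeff (Polynomial.smult c G - U * T) i \<in> {a \<in> A. \<phi> a = 0}"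
      by blast
    have "map_poly \<phi> (Polynomial.smult c G - U * T) = 0"
      using cU(3) by (intro poly_eqI) (simp del: coeff_diff)
    then have "Polynomial.smult (\<phi> c) (map_poly \<phi> G) = map_poly \<phi> U * map_poly \<phi> T"
      by (simp add: hom_distribs)
    then have "poly (Polynomial.smult (\<phi> c) (map_poly \<phi> G)) \<xi> = 0" by (simp add: \<xi>)
    then show ?thesis using cU by simp
  qed
  then show ?thesis by blast
qed

text \<open>The element \<open>a\<close> is chosen before \<phi>; this lets the induction on
  variables first find \<open>a\<close> and then ask for a \<phi> that does not kill it.\<close>

lemma extend_hom_nonzero:
  assumes A: "is_subring A" "A \<subseteq> S" and x: "x \<in> S"
    and inf: "infinite (UNIV :: 'w::alg_closed_field set)"
    and G: "G \<in> polys_over A" "poly G x \<notin> P"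
  obtains a where "a \<in> A - P"
    "\<And>\<phi> :: 'r \<Rightarrow> 'w. comm_ring_hom \<phi> \<Longrightarrow> (\<And>b. b \<in> P \<inter> A \<Longrightarrow> \<phi> b = 0) \<Longrightarrow> \<phi> a \<noteq> 0 \<Longrightarrow>
       \<exists>\<xi>. (\<forall>F\<in>polys_over A. poly F x \<in> P \<longrightarrow> poly (map_poly \<phi> F) \<xi> = 0) \<and>
           poly (map_poly \<phi> G) \<xi> \<noteq> 0"
proof (cases "\<forall>F\<in>polys_over A. poly F x \<in> P \<longrightarrow> (\<forall>i. poly.coeff F i \<in> P)")
  \<comment> \<open>Here \<open>x\<close> is transcendental over \<open>A\<close> modulo
    \<open>P\<close>: no equation restricts \<xi>, which only has to avoid the finitely many roots
    of the image of \<open>G\<close>. Any coefficient of \<open>G\<close> outside \<open>P\<close>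
    serves as \<open>a\<close>.\<close>
  case True
  obtain i where i: "poly.coeff G i \<notin> P" using poly_coeffs_in_P[OF x, of G] G(2) by blast
  show ?thesis
  proof (rule that)
    show "poly.coeff G i \<in> A - P" using i G by (auto simp: polys_over_def)
    fix \<phi> :: "'r \<Rightarrow> 'w"
    assume hom: "comm_ring_hom \<phi>" and ker: "\<And>b. b \<in> P \<inter> A \<Longrightarrow> \<phi> b = 0"
      and nz: "\<phi> (poly.coeff G i) \<noteq> 0"
    interpret comm_ring_hom \<phi> by fact
    have "map_poly \<phi> G \<noteq> 0" using nz by (auto simp: poly_eq_iff)
    then have "finite {\<xi>. poly (map_poly \<phi> G) \<xi> = 0}" by (rule poly_roots_finite)
    then obtain \<xi> where \<xi>: "poly (map_poly \<phi> G) \<xi> \<noteq> 0" using inf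
      by (metis (mono_tags, lifting) UNIV_eq_I mem_Collect_eq)
    moreover have "map_poly \<phi> F = 0" if "F \<in> polys_over A" "poly F x \<in> P" for F
      using that True ker by (intro poly_eqI) (auto simp: polys_over_def)
    ultimately show "\<exists>\<xi>. (\<forall>F\<in>polys_over A. poly F x \<in> P \<longrightarrow> poly (map_poly \<phi> F) \<xi> = 0) \<and>
      poly (map_poly \<phi> G) \<xi> \<noteq> 0" by (intro exI[of _ \<xi>]) auto
  qed
next
  case False
  then obtain F0 i where F0: "F0 \<in> polys_over A" "poly F0 x \<in> P" "poly.coeff F0 i \<notin> P" by blast
  obtain d where d: "top_degree F0 d" using F0(3) by (rule ex_top)
  obtain F where F: "F \<in> polys_over A" "poly F x \<in> P" "Polynomial.degree F = d"
    "poly.coeff F d = poly.coeff F0 d"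
    by (rule truncate[OF A x F0(1,2) d])
  \<comment> \<open>\<open>a1\<close> keeps the leading coefficient of an equation of
    \<open>x\<close> alive, as \<open>extend_hom\<close> requires; \<open>a2\<close>, a multiple of
    the value of \<open>G\<close> modulo \<open>P\<close>, keeps that value nonzero. Their product
    is the \<open>a\<close> sought.\<close>
  define a1 where "a1 = poly.coeff F d"
  have a1: "a1 \<in> A" "a1 \<notin> P"
    using F(1) d unfolding a1_def by (simp add: polys_over_def, simp add: F(4) top_degree_def)
  obtain a2 U where a2: "a2 \<in> A - P" "U \<in> polys_over A" "a2 - poly U x * poly G x \<in> P"
    using divides_nonzero_of_algebraic[OF A x F0 G] by blast
  show ?thesis
  proof (rule that)
    show "a1 * a2 \<in> A - P" using a1 a2(1) P_prime[of a1 a2] A(2) is_subring_simps(4)[OF A(1), of a1 a2] by auto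
    fix \<phi> :: "'r \<Rightarrow> 'w"
    assume hom: "comm_ring_hom \<phi>" and ker: "\<And>b. b \<in> P \<inter> A \<Longrightarrow> \<phi> b = 0"
      and nz: "\<phi> (a1 * a2) \<noteq> 0"
    interpret comm_ring_hom \<phi> by fact
    interpret \<phi>p: map_poly_comm_ring_hom \<phi> ..
    have nz': "\<phi> a1 \<noteq> 0" "\<phi> a2 \<noteq> 0" using nz by (auto simp: hom_distribs)
    then have "\<phi> (poly.coeff F (Polynomial.degree F)) \<noteq> 0" by (simp add: F(3) a1_def)
    from extend_hom[OF A x hom ker F(1,2) this] obtain \<xi> where
      \<xi>: "\<And>G. G \<in> polys_over A \<Longrightarrow> poly G x \<in> P \<Longrightarrow> poly (map_poly \<phi> G) \<xi> = 0" by blast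
    \<comment> \<open>This is an equation of \<open>x\<close>, hence its image has the root \<xi>;
      it reads \<phi>(a2) = U(\<xi>) G(\<xi>) after applying \<phi>.\<close>
    have "[:a2:] - U * G \<in> polys_over A"
      using a2 G const_in_polys_over[OF A(1)] is_subring_simps[OF is_subring_polys_over[OF A(1)]]
      by blast
    moreover have "poly ([:a2:] - U * G) x \<in> P" using a2 by simp
    ultimately have "poly (map_poly \<phi> ([:a2:] - U * G)) \<xi> = 0" by (rule \<xi>)
    then have "\<phi> a2 = poly (map_poly \<phi> U) \<xi> * poly (map_poly \<phi> G) \<xi>"
      by (simp add: hom_distribs)
    then show "\<exists>\<xi>. (\<forall>F\<in>polys_over A. poly F x \<in> P \<longrightarrow> poly (map_poly \<phi> F) \<xi> = 0) \<and>
      poly (map_poly \<phi> G) \<xi> \<noteq> 0" using \<xi> nz' by (intro exI[of _ \<xi>]) auto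
  qed
qed

end

section \<open>The Nullstellensatz\<close>

text \<open>The coefficient map \<kappa> is a parameter so that one set of lemmas covers
  substitution (\<open>psubst\<close>, with \<open>Const\<close>), points over the algebraic closure
  (with \<open>to_ac\<close>) and \<open>graded_eval\<close>.\<close>

definition eval_mpoly :: "('k \<Rightarrow> 'r) \<Rightarrow> ('v \<Rightarrow> 'r) \<Rightarrow> ('v, 'k::comm_ring_1) mpoly \<Rightarrow> 'r::comm_ring_1"
  where "eval_mpoly \<kappa> \<sigma> p = (\<Sum>t\<in>Poly_Mapping.keys p. \<kappa> (Poly_Mapping.lookup p t) *
    (\<Prod>v\<in>Poly_Mapping.keys t. \<sigma> v ^ Poly_Mapping.lookup t v))"

abbreviation monom_at :: "('v \<Rightarrow> 'r::comm_ring_1) \<Rightarrow> 'v monom \<Rightarrow> 'r"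
  where "monom_at \<sigma> t \<equiv> (\<Prod>v\<in>Poly_Mapping.keys t. \<sigma> v ^ Poly_Mapping.lookup t v)"

lemma monom_at_superset:
  assumes "finite V" "Poly_Mapping.keys t \<subseteq> V"
  shows "monom_at \<sigma> t = (\<Prod>v\<in>V. \<sigma> v ^ Poly_Mapping.lookup t v)"
  by (rule prod.mono_neutral_left) (use assms in \<open>auto simp: in_keys_iff\<close>)

lemma monom_at_add: "monom_at \<sigma> (s + t) = monom_at \<sigma> s * monom_at \<sigma> t"
proof -
  define V where "V = Poly_Mapping.keys s \<union> Poly_Mapping.keys t"
  have V: "finite V" "Poly_Mapping.keys s \<subseteq> V" "Poly_Mapping.keys t \<subseteq> V"
    "Poly_Mapping.keys (s + t) \<subseteq> V"
    using Poly_Mapping.keys_add[of s t] by (auto simp: V_def)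
  show ?thesis
    unfolding V(2-4)[THEN monom_at_superset[OF V(1)]]
    by (simp add: lookup_add power_add prod.distrib)
qed

lemma sum_single_lookup:
  "(\<Sum>t\<in>Poly_Mapping.keys p. Poly_Mapping.single t (Poly_Mapping.lookup p t)) = p"
  by (rule poly_mapping_eqI)
    (auto simp: lookup_sum lookup_single when_def in_keys_iff)

context
  fixes \<kappa> :: "'k::comm_ring_1 \<Rightarrow> 'r::comm_ring_1" and \<sigma> :: "'v \<Rightarrow> 'r"
  assumes \<kappa>: "comm_ring_hom \<kappa>"
begin

interpretation comm_ring_hom \<kappa> by (rule \<kappa>)

lemma eval_mpoly_superset:
  assumes "finite T" "Poly_Mapping.keys p \<subseteq> T"
  shows "eval_mpoly \<kappa> \<sigma> p = (\<Sum>t\<in>T. \<kappa> (Poly_Mapping.lookup p t) * monom_at \<sigma> t)"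
  unfolding eval_mpoly_def
  by (rule sum.mono_neutral_left) (use assms in \<open>auto simp: in_keys_iff\<close>)

lemma eval_mpoly_zero [simp]: "eval_mpoly \<kappa> \<sigma> 0 = 0"
  by (simp add: eval_mpoly_def)

lemma eval_mpoly_add: "eval_mpoly \<kappa> \<sigma> (p + q) = eval_mpoly \<kappa> \<sigma> p + eval_mpoly \<kappa> \<sigma> q"
proof -
  define T where "T = Poly_Mapping.keys p \<union> Poly_Mapping.keys q"
  have T: "finite T" "Poly_Mapping.keys p \<subseteq> T" "Poly_Mapping.keys q \<subseteq> T"
    "Poly_Mapping.keys (p + q) \<subseteq> T"
    using Poly_Mapping.keys_add[of p q] by (auto simp: T_def)
  show ?thesis
    unfolding T(2-4)[THEN eval_mpoly_superset[OF T(1)]]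
    by (simp add: lookup_add hom_distribs algebra_simps sum.distrib)
qed

lemma eval_mpoly_sum: "eval_mpoly \<kappa> \<sigma> (sum f I) = (\<Sum>i\<in>I. eval_mpoly \<kappa> \<sigma> (f i))"
  by (induction I rule: infinite_finite_induct) (auto simp: eval_mpoly_add)

lemma eval_mpoly_single: "eval_mpoly \<kappa> \<sigma> (Poly_Mapping.single t c) = \<kappa> c * monom_at \<sigma> t"
  by (cases "c = 0") (auto simp: eval_mpoly_def)

lemma eval_mpoly_mult: "eval_mpoly \<kappa> \<sigma> (p * q) = eval_mpoly \<kappa> \<sigma> p * eval_mpoly \<kappa> \<sigma> q"
proof -
  let ?p = "\<lambda>t. Poly_Mapping.single t (Poly_Mapping.lookup p t)"
  let ?q = "\<lambda>t. Poly_Mapping.single t (Poly_Mapping.lookup q t)"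
  have "p * q = (\<Sum>s\<in>Poly_Mapping.keys p. \<Sum>t\<in>Poly_Mapping.keys q. ?p s * ?q t)"
    using sum_product[of ?p "Poly_Mapping.keys p" ?q "Poly_Mapping.keys q"]
    by (simp add: sum_single_lookup)
  then have "eval_mpoly \<kappa> \<sigma> (p * q) =
      (\<Sum>s\<in>Poly_Mapping.keys p. \<Sum>t\<in>Poly_Mapping.keys q.
        (\<kappa> (Poly_Mapping.lookup p s) * monom_at \<sigma> s) * (\<kappa> (Poly_Mapping.lookup q t) * monom_at \<sigma> t))"
    by (simp add: eval_mpoly_sum mult_single eval_mpoly_single monom_at_add hom_distribs ac_simps)
  then show ?thesis by (simp add: sum_product eval_mpoly_def)
qed

lemma eval_mpoly_hom: "comm_ring_hom (eval_mpoly \<kappa> \<sigma>)"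
proof
  show "eval_mpoly \<kappa> \<sigma> 1 = 1"
    using eval_mpoly_single[of 0 1] by simp
qed (auto simp: eval_mpoly_add eval_mpoly_mult)

lemma eval_mpoly_Var [simp]: "eval_mpoly \<kappa> \<sigma> (Var v) = \<sigma> v"
  by (simp add: Var_def eval_mpoly_single)

lemma eval_mpoly_Const [simp]: "eval_mpoly \<kappa> \<sigma> (Const c) = \<kappa> c"
  by (simp add: Const_def eval_mpoly_single)

end

lemma Const_hom: "comm_ring_hom (Const :: 'k::comm_ring_1 \<Rightarrow> ('v, 'k) mpoly)"
  by standard (auto simp: Const_def single_add mult_single)

lemma psubst_eq_eval: "psubst \<sigma> = eval_mpoly Const \<sigma>"
  by (simp add: fun_eq_iff psubst_def eval_mpoly_def)

lemma psubst_hom: "comm_ring_hom (psubst \<sigma>)"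
  unfolding psubst_eq_eval by (rule eval_mpoly_hom[OF Const_hom])

lemma psubst_Var [simp]: "psubst \<sigma> (Var v) = \<sigma> v"
  unfolding psubst_eq_eval by (rule eval_mpoly_Var[OF Const_hom])

lemma psubst_Const [simp]: "psubst \<sigma> (Const c) = Const c"
  unfolding psubst_eq_eval by (rule eval_mpoly_Const[OF Const_hom])

lemma hom_eval_mpoly:
  assumes "comm_ring_hom h"
  shows "h (eval_mpoly \<kappa> \<sigma> p) = eval_mpoly (h \<circ> \<kappa>) (h \<circ> \<sigma>) p"
proof -
  interpret comm_ring_hom h by fact
  show ?thesis by (simp add: eval_mpoly_def hom_distribs)
qed

lemma eval_mpoly_cong:
  assumes "\<And>v t. t \<in> Poly_Mapping.keys p \<Longrightarrow> v \<in> Poly_Mapping.keys t \<Longrightarrow> \<sigma> v = \<sigma>' v"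
  shows "eval_mpoly \<kappa> \<sigma> p = eval_mpoly \<kappa> \<sigma>' p"
  unfolding eval_mpoly_def using assms by (auto intro!: sum.cong prod.cong)

lemma Var_power: "Var v ^ k = Poly_Mapping.single (Poly_Mapping.single v k) 1"
  by (induction k) (auto simp: Var_def mult_single single_add[symmetric])

lemma prod_Var_power:
  "(\<Prod>v\<in>V. Var v ^ k v) = Poly_Mapping.single (\<Sum>v\<in>V. Poly_Mapping.single v (k v)) 1"
  by (induction V rule: infinite_finite_induct) (auto simp: Var_power mult_single)

lemma mpoly_eq_eval: "eval_mpoly Const Var p = p"
  by (simp add: eval_mpoly_def prod_Var_power sum_single_lookup Const_def mult_single)

section \<open>Polynomials in a subset of the variables\<close>

lemma poly_ring_carrier:
  "p \<in> carrier (Defs.poly_ring U) \<longleftrightarrow> (\<forall>t\<in>Poly_Mapping.keys p. Poly_Mapping.keys t \<subseteq> U)"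
  by (simp add: Defs.poly_ring_def)

lemma poly_ring_ops [simp]:
  "p \<otimes>\<^bsub>Defs.poly_ring U\<^esub> q = p * q" "p \<oplus>\<^bsub>Defs.poly_ring U\<^esub> q = p + q"
  "\<zero>\<^bsub>Defs.poly_ring U\<^esub> = 0" "\<one>\<^bsub>Defs.poly_ring U\<^esub> = 1"
  by (simp_all add: Defs.poly_ring_def)

lemma is_subring_poly_ring:
  "is_subring (carrier (Defs.poly_ring U :: ('v, 'k::comm_ring_1) mpoly ring))"
proof -
  interpret cring "Defs.poly_ring U :: ('v, 'k) mpoly ring" by (rule cring_poly_ring)
  have "p - q \<in> carrier (Defs.poly_ring U)"
    if "p \<in> carrier (Defs.poly_ring U)" "q \<in> carrier (Defs.poly_ring U)" for p q :: "('v, 'k) mpoly"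
  proof -
    have "Poly_Mapping.keys (p - q) \<subseteq> Poly_Mapping.keys p \<union> Poly_Mapping.keys q"
      by (auto simp: in_keys_iff lookup_minus)
    then show ?thesis using that unfolding poly_ring_carrier by blast
  qed
  moreover have "p * q \<in> carrier (Defs.poly_ring U)"
    if "p \<in> carrier (Defs.poly_ring U)" "q \<in> carrier (Defs.poly_ring U)" for p q :: "('v, 'k) mpoly"
    using m_closed[OF that] by simp
  moreover have "1 \<in> carrier (Defs.poly_ring U :: ('v, 'k) mpoly ring)"
    using one_closed by simp
  ultimately show ?thesis by (simp add: is_subring_def)
qed

lemma Var_in_poly_ring [simp]: "Var v \<in> carrier (Defs.poly_ring U) \<longleftrightarrow> v \<in> U"
  by (simp add: poly_ring_carrier Var_def)

lemma Const_in_poly_ring [simp]: "Const c \<in> carrier (Defs.poly_ring U)"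
  by (auto simp: poly_ring_carrier Const_def)

lemma poly_ring_mono: "U \<subseteq> V \<Longrightarrow> carrier (Defs.poly_ring U) \<subseteq> carrier (Defs.poly_ring V)"
  unfolding subset_iff[of "carrier _"] poly_ring_carrier by blast

lemma poly_ring_empty:
  assumes "p \<in> carrier (Defs.poly_ring {})"
  obtains c where "p = Const c"
proof
  show "p = Const (Poly_Mapping.lookup p 0)"
    by (rule poly_mapping_eqI)
      (use assms in \<open>auto simp: poly_ring_carrier Const_def lookup_single when_def in_keys_iff\<close>)
qed

lemma eval_mpoly_in_subring:
  assumes B: "is_subring B" and "\<And>c. \<kappa> c \<in> B" "\<And>v. v \<in> U \<Longrightarrow> \<sigma> v \<in> B"
    and p: "p \<in> carrier (Defs.poly_ring U)"
  shows "eval_mpoly \<kappa> \<sigma> p \<in> B"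
proof -
  have "(\<Prod>v\<in>V. \<sigma> v ^ k v) \<in> B" if "V \<subseteq> U" for V k
    using that by (induction V rule: infinite_finite_induct) (auto simp: is_subring_simps[OF B] assms)
  then show ?thesis
    unfolding eval_mpoly_def using p
    by (intro is_subring_sum[OF B] is_subring_simps(4)[OF B] assms) (auto simp: poly_ring_carrier)
qed

lemma comm_ring_hom_poly: "comm_ring_hom (\<lambda>p. poly p x)"
  by standard auto

text \<open>Send \<open>v\<close> to \<open>X\<close> and every other variable to a constant;
  putting \<open>v\<close> back for \<open>X\<close> returns each variable to itself.\<close>

lemma poly_over_poly_ring:
  assumes "p \<in> carrier (Defs.poly_ring (insert v U))"
  obtains G where "G \<in> polys_over (carrier (Defs.poly_ring U))" "poly G (Var v) = p"
proof
  let ?B = "polys_over (carrier (Defs.poly_ring U)) :: ('a, 'b) mpoly poly set"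
  note sub = is_subring_poly_ring[of U]
  define G where "G = eval_mpoly (\<lambda>c. [:Const c:]) (\<lambda>w. if w = v then [:0, 1:] else [:Var w:]) p"
  have X: "[:0, 1:] \<in> ?B"
    using monom_in_polys_over[OF sub is_subring_simps(1)[OF sub], of 1] by (simp add: monom_altdef)
  show "G \<in> ?B" unfolding G_def
    by (rule eval_mpoly_in_subring[OF is_subring_polys_over[OF sub] _ _ assms])
      (auto intro: X const_in_polys_over[OF sub])
  have "poly G (Var v) = eval_mpoly Const Var p"
    unfolding G_def by (simp add: hom_eval_mpoly[OF comm_ring_hom_poly] comp_def if_distrib[of "\<lambda>q. poly q _"]
      if_distrib[of Var, symmetric] cong: if_cong)
  then show "poly G (Var v) = p" by (simp add: mpoly_eq_eval)
qed

lemma to_ac_hom: "comm_ring_hom to_ac"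
  by standard auto

text \<open>Induction on a subset \<open>U\<close> of the variables, for the trace of
  \<open>P\<close> on the polynomials in \<open>U\<close>. At each stage the values of \<omega>
  outside \<open>U\<close> are arbitrary, and one of them is corrected when \<open>U\<close>
  grows.\<close>

lemma nullstellensatz:
  fixes P :: "('v, 'k::field) mpoly set"
  assumes inf: "infinite (UNIV :: 'k set)" and T: "finite T"
    and prime: "prime_in (carrier (Defs.poly_ring T)) P"
    and f: "f \<in> carrier (Defs.poly_ring T)" "f \<notin> P"
  shows "\<exists>\<omega> :: 'v \<Rightarrow> 'k alg_closure. (\<forall>p\<in>P. eval_mpoly to_ac \<omega> p = 0) \<and> eval_mpoly to_ac \<omega> f \<noteq> 0"
proof -
  let ?S = "\<lambda>U. carrier (Defs.poly_ring U) :: ('v, 'k) mpoly set"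
  interpret prime_in "?S T" P by fact
  have "infinite (range to_ac :: 'k alg_closure set)" using inf inj_to_ac finite_imageD by blast
  then have inf': "infinite (UNIV :: 'k alg_closure set)" by (rule infinite_super[rotated]) simp
  have "\<exists>\<omega> :: 'v \<Rightarrow> 'k alg_closure. (\<forall>p\<in>P \<inter> ?S U. eval_mpoly to_ac \<omega> p = 0) \<and> eval_mpoly to_ac \<omega> f \<noteq> 0"
    if "finite U" "U \<subseteq> T" "f \<in> ?S U - P" for U f
    using that
  proof (induction U arbitrary: f rule: finite_induct)
    case empty
    \<comment> \<open>A proper ideal contains no nonzero constant, since these are units.\<close>
    have p0: "p = 0" if pP: "p \<in> P \<inter> ?S {}" for p
    proof (rule ccontr)
      assume "p \<noteq> 0"
      obtain c where c: "p = Const c" by (rule poly_ring_empty[of p]) (use pP in auto)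
      then have "c \<noteq> 0" using \<open>p \<noteq> 0\<close> by (auto simp: Const_def)
      then have "Const (1 / c) * p = 1" by (simp add: c Const_def mult_single)
      moreover have "Const (1 / c) * p \<in> P" using pP P_mult by auto
      ultimately show False using P_one by simp
    qed
    obtain c where c: "f = Const c" by (rule poly_ring_empty[of f]) (use empty in auto)
    moreover have "c \<noteq> 0" using empty P_zero by (auto simp: c Const_def)
    moreover have "\<forall>p\<in>P \<inter> ?S {}. eval_mpoly to_ac \<omega> p = 0" for \<omega> :: "'v \<Rightarrow> 'k alg_closure"
      by (auto dest!: p0[OF IntI] simp: eval_mpoly_zero[OF to_ac_hom])
    ultimately show ?case by (simp add: eval_mpoly_Const[OF to_ac_hom])
  next
    case (insert v U)
    have A: "is_subring (?S U)" "?S U \<subseteq> ?S T"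
      using insert.prems poly_ring_mono[of U T] by (auto simp: is_subring_poly_ring)
    have x: "Var v \<in> ?S T" using insert.prems by simp
    obtain G where G: "G \<in> polys_over (?S U)" "poly G (Var v) = f"
      by (rule poly_over_poly_ring[of f v U]) (use insert.prems in auto)
    then have "poly G (Var v) \<notin> P" using insert.prems by simp
    from extend_hom_nonzero[OF A x inf' G(1) this] obtain a where a: "a \<in> ?S U - P"
      "\<And>\<phi> :: ('v, 'k) mpoly \<Rightarrow> 'k alg_closure. comm_ring_hom \<phi> \<Longrightarrow> (\<And>b. b \<in> P \<inter> ?S U \<Longrightarrow> \<phi> b = 0) \<Longrightarrow>
        \<phi> a \<noteq> 0 \<Longrightarrow>
         \<exists>\<xi>. (\<forall>F\<in>polys_over (?S U). poly F (Var v) \<in> P \<longrightarrow> poly (map_poly \<phi> F) \<xi> = 0) \<and>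
           poly (map_poly \<phi> G) \<xi> \<noteq> 0" by blast
    \<comment> \<open>The induction hypothesis is applied to \<open>a\<close>, which involves only
      variables of \<open>U\<close>, instead of \<open>f\<close>.\<close>
    obtain \<omega> :: "'v \<Rightarrow> 'k alg_closure" where \<omega>: "\<forall>p\<in>P \<inter> ?S U. eval_mpoly to_ac \<omega> p = 0"
      "eval_mpoly to_ac \<omega> a \<noteq> 0"
      using insert.IH[OF _ a(1)] insert.prems by auto
    obtain \<xi> where \<xi>: "\<And>F. F \<in> polys_over (?S U) \<Longrightarrow> poly F (Var v) \<in> P \<Longrightarrow>
        poly (map_poly (eval_mpoly to_ac \<omega>) F) \<xi> = 0"
      "poly (map_poly (eval_mpoly to_ac \<omega>) G) \<xi> \<noteq> 0"
      using a(2)[OF eval_mpoly_hom[OF to_ac_hom], of \<omega>] \<omega> by blast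
    \<comment> \<open>As \<open>v\<close> is not in \<open>U\<close>, polynomials in the variables
      of \<open>U\<close> keep their values.\<close>
    define \<omega>' where "\<omega>' = \<omega>(v := \<xi>)"
    interpret h: comm_ring_hom "eval_mpoly to_ac \<omega>' :: ('v, 'k) mpoly \<Rightarrow> _"
      by (rule eval_mpoly_hom[OF to_ac_hom])
    interpret h0: comm_ring_hom "eval_mpoly to_ac \<omega> :: ('v, 'k) mpoly \<Rightarrow> _"
      by (rule eval_mpoly_hom[OF to_ac_hom])
    have ev: "eval_mpoly to_ac \<omega>' (poly F (Var v)) = poly (map_poly (eval_mpoly to_ac \<omega>) F) \<xi>"
      if "F \<in> polys_over (?S U)" for F
    proof -
      have "eval_mpoly to_ac \<omega>' (poly.coeff F i) = eval_mpoly to_ac \<omega> (poly.coeff F i)" for i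
        using that insert.hyps unfolding \<omega>'_def
        by (intro eval_mpoly_cong) (auto simp: polys_over_def poly_ring_carrier)
      then have "map_poly (eval_mpoly to_ac \<omega>') F = map_poly (eval_mpoly to_ac \<omega>) F"
        by (intro poly_eqI) simp
      then show ?thesis
        using h.poly_map_poly[of F "Var v"] by (simp add: eval_mpoly_Var[OF to_ac_hom] \<omega>'_def)
    qed
    have "eval_mpoly to_ac \<omega>' p = 0" if pP: "p \<in> P \<inter> ?S (insert v U)" for p
    proof -
      obtain F where "F \<in> polys_over (?S U)" "poly F (Var v) = p"
        by (rule poly_over_poly_ring[of p v U]) (use pP in auto)
      then show ?thesis using ev[of F] \<xi>(1)[of F] pP by simp
    qed
    moreover have "eval_mpoly to_ac \<omega>' f \<noteq> 0" using ev[OF G(1)] \<xi>(2) G(2) by simp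
    ultimately show ?case by blast
  qed
  from this[OF T, of f] f show ?thesis using P_sub by (metis Diff_iff Int_absorb2 order_refl)
qed

section \<open>Pullbacks of Pluecker coordinates\<close>

text \<open>Expanding the rows of the product gives a sum over maps \<open>f\<close> from
  \<open>{0..<q}\<close> to \<open>T\<close>. Maps that are not injective contribute determinants
  with two equal rows. An injective \<open>f\<close> is uniquely a list of \<open>E\<close> composed
  with a permutation, whose sign comes out of the second determinant and completes the first to a
  Leibniz sum.\<close>

lemma cauchy_binet:
  fixes M :: "nat \<Rightarrow> 'a \<Rightarrow> 'r::comm_ring_1" and N :: "'a \<Rightarrow> nat \<Rightarrow> 'r"
  assumes T: "finite T"
    and E: "\<And>L. L \<in> E \<Longrightarrow> distinct L" "\<And>L. L \<in> E \<Longrightarrow> length L = q" "\<And>L. L \<in> E \<Longrightarrow> set L \<subseteq> T"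
    and ex: "\<And>B. B \<subseteq> T \<Longrightarrow> card B = q \<Longrightarrow> \<exists>L\<in>E. set L = B"
    and unique: "\<And>L L'. L \<in> E \<Longrightarrow> L' \<in> E \<Longrightarrow> set L = set L' \<Longrightarrow> L = L'"
  shows "det (mat q q (\<lambda>(i, j). \<Sum>t\<in>T. M i t * N t j)) =
    (\<Sum>L\<in>E. det (mat q q (\<lambda>(i, j). M i (L ! j))) * det (mat q q (\<lambda>(i, j). N (L ! i) j)))"
proof -
  define U where "U = {0..<q}"
  define Pm where "Pm = {p. p permutes U}"
  define D where "D f = det (mat q q (\<lambda>(i, j). N (f i) j))" for f
  define F where "F = {f \<in> U \<rightarrow>\<^sub>E T. inj_on f U}"
  define h where "h = (\<lambda>(L, p). restrict (\<lambda>i. L ! p i) U :: nat \<Rightarrow> 'a)"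
  have perm_lt: "p i < q" if "p \<in> Pm" "i < q" for p i
    using permutes_in_image[of p U i] that by (auto simp: Pm_def U_def)
  have finPm: "finite Pm" by (simp add: Pm_def U_def finite_permutations)
  have det_eq: "det (mat q q f) = (\<Sum>p\<in>Pm. signof p * (\<Prod>i\<in>U. f (i, p i)))" for f :: "_ \<Rightarrow> 'r"
    by (subst det_def'[of _ q]) (auto simp: Pm_def U_def perm_lt[unfolded Pm_def U_def] intro!: sum.cong prod.cong)
  have "det (mat q q (\<lambda>(i, j). \<Sum>t\<in>T. M i t * N t j)) =
      (\<Sum>p\<in>Pm. signof p * (\<Sum>f\<in>U \<rightarrow>\<^sub>E T. \<Prod>i\<in>U. M i (f i) * N (f i) (p i)))"
    unfolding det_eq by (simp add: prod_sum_PiE[OF _ T] U_def T)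
  also have "\<dots> = (\<Sum>f\<in>U \<rightarrow>\<^sub>E T. \<Sum>p\<in>Pm. signof p * (\<Prod>i\<in>U. M i (f i) * N (f i) (p i)))"
    unfolding sum_distrib_left by (rule sum.swap)
  also have "\<dots> = (\<Sum>f\<in>U \<rightarrow>\<^sub>E T. (\<Prod>i\<in>U. M i (f i)) * D f)"
    unfolding D_def det_eq by (simp add: prod.distrib sum_distrib_left ac_simps)
  also have "\<dots> = (\<Sum>f\<in>F. (\<Prod>i\<in>U. M i (f i)) * D f)"
  proof (rule sum.mono_neutral_right)
    show "finite (U \<rightarrow>\<^sub>E T)" by (simp add: finite_PiE T U_def)
    show "F \<subseteq> U \<rightarrow>\<^sub>E T" by (auto simp: F_def)
    show "\<forall>f\<in>(U \<rightarrow>\<^sub>E T) - F. (\<Prod>i\<in>U. M i (f i)) * D f = 0"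
    proof
      fix f assume "f \<in> (U \<rightarrow>\<^sub>E T) - F"
      then obtain i j where ij: "i < q" "j < q" "i \<noteq> j" "f i = f j"
        by (auto simp: F_def inj_on_def U_def)
      have "D f = 0" unfolding D_def
        by (rule det_identical_rows[of _ q i j]) (use ij in \<open>auto simp: row_def\<close>)
      then show "(\<Prod>i\<in>U. M i (f i)) * D f = 0" by simp
    qed
  qed
  also have "\<dots> = (\<Sum>z\<in>E \<times> Pm. (\<Prod>i\<in>U. M i (h z i)) * D (h z))"
  proof (rule sum.reindex_bij_betw[symmetric], rule bij_betw_imageI)
    have set_h: "h (L, p) ` U = set L" if "L \<in> E" "p \<in> Pm" for L p
    proof -
      have "h (L, p) ` U = (!) L ` (p ` U)" by (auto simp: h_def)
      also have "\<dots> = (!) L ` U" using that by (simp add: Pm_def permutes_image)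
      also have "\<dots> = set L" using E(2)[OF that(1)] by (auto simp: U_def set_conv_nth)
      finally show ?thesis .
    qed
    show "inj_on h (E \<times> Pm)"
    proof (rule inj_onI, clarsimp)
      fix L p L' p' assume *: "L \<in> E" "p \<in> Pm" "L' \<in> E" "p' \<in> Pm" "h (L, p) = h (L', p')"
      then have "L = L'" using set_h[of L p] set_h[of L' p'] unique by simp
      have "p i = p' i" for i
      proof (cases "i < q")
        case True
        then have "L ! p i = L ! p' i"
          using fun_cong[OF *(5), of i] by (simp add: h_def \<open>L = L'\<close> U_def)
        then show ?thesis
          using nth_eq_iff_index_eq[OF E(1)[OF *(1)]] perm_lt True * E(2) by simp
      next
        case False
        then show ?thesis using * by (auto simp: Pm_def U_def permutes_def)
      qed
      then show "L = L' \<and> p = p'" using \<open>L = L'\<close> by auto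
    qed
    show "h ` (E \<times> Pm) = F"
    proof (intro equalityI subsetI)
      fix f assume "f \<in> h ` (E \<times> Pm)"
      then obtain L p where f: "L \<in> E" "p \<in> Pm" "f = h (L, p)" by auto
      have "inj_on f U"
      proof (rule inj_onI)
        fix i j assume "i \<in> U" "j \<in> U" "f i = f j"
        then have "p i = p j"
          using f nth_eq_iff_index_eq[OF E(1)[OF f(1)], of "p i" "p j"] perm_lt E(2)
          by (simp add: h_def U_def)
        then show "i = j" using f permutes_inj[of p U] by (simp add: Pm_def inj_eq)
      qed
      moreover have "f \<in> U \<rightarrow>\<^sub>E T"
        using set_h[OF f(1,2)] E(3)[OF f(1)] f(3) by (auto simp: h_def)
      ultimately show "f \<in> F" by (simp add: F_def)
    next
      fix f assume f: "f \<in> F"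
      then have inj: "inj_on f U" and "f ` U \<subseteq> T" by (auto simp: F_def)
      moreover have "card (f ` U) = q" using card_image[OF inj] by (simp add: U_def)
      ultimately obtain L where L: "L \<in> E" "set L = f ` U" using ex by blast
      have bL: "bij_betw ((!) L) U (f ` U)"
        by (rule bij_betw_nth[OF E(1)[OF L(1)] _ L(2)[symmetric]])
          (use E(2)[OF L(1)] in \<open>auto simp: U_def\<close>)
      \<comment> \<open>\<open>permutes\<close> demands the identity outside \<open>U\<close>; since
        \<open>h\<close> restricts to \<open>U\<close>, this does not affect
        \<open>h (L, p)\<close>.\<close>
      define p where "p = (\<lambda>i. if i \<in> U then inv_into U ((!) L) (f i) else i)"
      have "bij_betw (inv_into U ((!) L) \<circ> f) U U"
        by (rule bij_betw_trans[OF _ bij_betw_inv_into[OF bL]]) (use inj in \<open>simp add: bij_betw_def\<close>)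
      then have "bij_betw p U U"
        by (rule bij_betw_cong[THEN iffD1, rotated]) (simp add: p_def)
      then have "p \<in> Pm" unfolding Pm_def
        by (intro CollectI bij_imp_permutes) (auto simp: p_def)
      moreover have "h (L, p) = f"
      proof
        fix i
        have "L ! p i = f i" if "i \<in> U"
          using that bij_betw_inv_into_right[OF bL, of "f i"] by (simp add: p_def)
        moreover have "f i = undefined" if "i \<notin> U" using f that by (auto simp: F_def)
        ultimately show "h (L, p) i = f i" by (simp add: h_def)
      qed
      ultimately show "f \<in> h ` (E \<times> Pm)" using L by force
    qed
  qed
  also have "\<dots> = (\<Sum>L\<in>E. \<Sum>p\<in>Pm. (\<Prod>i\<in>U. M i (L ! p i)) * (signof p * det (mat q q (\<lambda>(i, j). N (L ! i) j))))"
    unfolding sum.cartesian_product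
  proof (rule sum.cong[OF refl], clarify)
    fix L p assume *: "L \<in> E" "p \<in> Pm"
    have "D (h (L, p)) = det (mat q q (\<lambda>(i, j). mat q q (\<lambda>(i, j). N (L ! i) j) $$ (p i, j)))"
      unfolding D_def
      by (rule arg_cong[of _ _ det], rule eq_matI) (use perm_lt[OF *(2)] in \<open>auto simp: h_def U_def\<close>)
    also have "\<dots> = signof p * det (mat q q (\<lambda>(i, j). N (L ! i) j))"
      by (rule det_permute_rows) (use * in \<open>auto simp: Pm_def U_def\<close>)
    finally show "(\<Prod>i\<in>U. M i (h (L, p) i)) * D (h (L, p)) =
      (\<Prod>i\<in>U. M i (L ! p i)) * (signof p * det (mat q q (\<lambda>(i, j). N (L ! i) j)))"
      by (simp add: h_def)
  qed
  also have "\<dots> = (\<Sum>L\<in>E. det (mat q q (\<lambda>(i, j). M i (L ! j))) * det (mat q q (\<lambda>(i, j). N (L ! i) j)))"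
    by (rule sum.cong[OF refl], subst (2) det_eq) (simp add: sum_distrib_left sum_distrib_right ac_simps)
  finally show ?thesis .
qed

section \<open>Decreasing lists as unique representatives of finite sets of terms\<close>

lemma sorted_wrt_distinct:
  assumes "\<And>x. \<not> R x x" "sorted_wrt R L" shows "distinct L"
  using assms(2) by (induction L) (use assms(1) in auto)

lemma sorted_wrt_unique:
  assumes "\<And>x. \<not> R x x" "\<And>x y z. R x y \<Longrightarrow> R y z \<Longrightarrow> R x z"
  shows "sorted_wrt R L \<Longrightarrow> sorted_wrt R M \<Longrightarrow> set L = set M \<Longrightarrow> L = M"
proof (induction L arbitrary: M)
  case (Cons a L)
  then obtain b M' where M: "M = b # M'" by (cases M) auto
  have "a = b" using Cons.prems assms M by (metis list.set_intros(1) set_ConsD sorted_wrt.simps(2))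
  moreover have "a \<notin> set L" "b \<notin> set M'" using Cons.prems assms M by auto
  ultimately have "set L = set M'" using Cons.prems M by auto
  then show ?case using Cons M \<open>a = b\<close> by simp
qed simp

lemma ex_sorted_wrt:
  assumes "finite B" "\<And>x. \<not> R x x" "\<And>x y z. R x y \<Longrightarrow> R y z \<Longrightarrow> R x z"
    and "\<And>x y. x \<in> B \<Longrightarrow> y \<in> B \<Longrightarrow> x \<noteq> y \<Longrightarrow> R x y \<or> R y x"
  shows "\<exists>L. set L = B \<and> sorted_wrt R L"
  using assms(1,4)
proof (induction B rule: finite_psubset_induct)
  case (psubset B)
  show ?case
  proof (cases "B = {}")
    case False
    have "asymp_on B R" "transp_on B R"
      using assms(2,3) by (auto intro!: asymp_onI transp_onI)
    then obtain a where a: "a \<in> B" "\<forall>x\<in>B. x \<noteq> a \<longrightarrow> \<not> R x a"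
      using Finite_Set.bex_min_element[OF psubset.hyps(1), of R] False by blast
    have "\<exists>L. set L = B - {a} \<and> sorted_wrt R L" using psubset.IH[of "B - {a}"] psubset.prems a by blast
    then obtain L where L: "set L = B - {a}" "sorted_wrt R L" by blast
    then have "sorted_wrt R (a # L)" "set (a # L) = B" using a psubset.prems by auto
    then show ?thesis by blast
  qed auto
qed

lemma finite_terms_deg: "finite (terms_deg n m)"
proof -
  have "inj_on (\<lambda>t :: nat monom. restrict (Poly_Mapping.lookup t) {..n}) (terms_deg n m)"
  proof (rule inj_onI)
    fix s t :: "nat monom"
    assume *: "s \<in> terms_deg n m" "t \<in> terms_deg n m"
      "restrict (Poly_Mapping.lookup s) {..n} = restrict (Poly_Mapping.lookup t) {..n}"
    show "s = t"
    proof (rule poly_mapping_eqI)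
      fix k
      show "Poly_Mapping.lookup s k = Poly_Mapping.lookup t k"
      proof (cases "k \<le> n")
        case True
        then show ?thesis using fun_cong[OF *(3), of k] by simp
      next
        case False
        then have "k \<notin> Poly_Mapping.keys s" "k \<notin> Poly_Mapping.keys t"
          using * by (auto simp: terms_deg_def terms_def)
        then show ?thesis by (simp add: in_keys_iff)
      qed
    qed
  qed
  moreover have "(\<lambda>t. restrict (Poly_Mapping.lookup t) {..n}) ` terms_deg n m \<subseteq> {..n} \<rightarrow>\<^sub>E {..m}"
  proof -
    have le: "Poly_Mapping.lookup t k \<le> mdeg t" for t :: "nat monom" and k
      by (cases "k \<in> Poly_Mapping.keys t") (auto simp: mdeg_def in_keys_iff intro!: member_le_sum)
    show ?thesis by (auto simp: terms_deg_def le split: if_splits)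
  qed
  ultimately show ?thesis by (metis finite_PiE finite_atMost inj_on_finite)
qed

context
  fixes n :: nat and r :: "nat monom rel"
  assumes r: "term_order n r"
begin

lemma term_order_strict: "(s, s) \<notin> r" "(s, t) \<in> r \<Longrightarrow> (t, u) \<in> r \<Longrightarrow> (s, u) \<in> r"
  using r unfolding term_order_def strict_linear_order_on_def irrefl_def trans_def by blast+

lemma ext_terms_distinct: "L \<in> ext_terms n m q r \<Longrightarrow> distinct L"
  by (rule sorted_wrt_distinct[of "\<lambda>s t. (t, s) \<in> r"]) (auto simp: ext_terms_def term_order_strict)

lemma ext_terms_unique:
  "L \<in> ext_terms n m q r \<Longrightarrow> L' \<in> ext_terms n m q r \<Longrightarrow> set L = set L' \<Longrightarrow> L = L'"
  by (rule sorted_wrt_unique[of "\<lambda>s t. (t, s) \<in> r"])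
    (auto simp: ext_terms_def term_order_strict(1) intro: term_order_strict(2))

lemma ex_ext_term:
  assumes B: "B \<subseteq> terms_deg n m" "card B = q"
  shows "\<exists>L\<in>ext_terms n m q r. set L = B"
proof -
  have "finite B" using B finite_terms_deg finite_subset by blast
  moreover have "(t, s) \<in> r \<or> (s, t) \<in> r" if "s \<in> B" "t \<in> B" "s \<noteq> t" for s t
    using r B that unfolding term_order_def strict_linear_order_on_def total_on_def terms_deg_def by blast
  ultimately have "\<exists>L. set L = B \<and> sorted_wrt (\<lambda>s t. (t, s) \<in> r) L"
    by (intro ex_sorted_wrt) (auto simp: term_order_strict(1) intro: term_order_strict(2))
  then obtain L where L: "set L = B" "sorted_wrt (\<lambda>s t. (t, s) \<in> r) L" by blast
  moreover have "distinct L" by (rule sorted_wrt_distinct[OF _ L(2)]) (simp add: term_order_strict)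
  ultimately show ?thesis using B distinct_card[of L] by (auto simp: ext_terms_def)
qed

end

lemma finite_ext_terms: "finite (ext_terms n m q r)"
  by (rule finite_subset[OF _ finite_lists_length_eq[OF finite_terms_deg, of n m q]])
    (auto simp: ext_terms_def)

text \<open>The pullback along \<open>g\<close> corresponds, under the embedding of the Pluecker coordinate ring into
  the polynomial ring of the generic matrix, to the linear substitution of the columns by \<open>g\<close>.\<close>

lemma generic_minor_pullback:
  fixes g :: "'k::field mat"
  assumes r: "term_order n r" and L: "L \<in> ext_terms n m q r"
  shows "(\<Sum>L'\<in>ext_terms n m q r. Const (ext_act_coeff n q g L L') * generic_minor q L') =
    psubst (\<lambda>(i, s). \<Sum>t\<in>terms_deg n m.
      Const (Poly_Mapping.lookup (act n g (Poly_Mapping.single t 1)) s) * Var (i, t)) (generic_minor q L)"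
    (is "_ = psubst ?\<tau> _")
proof -
  define a where "a s t = Poly_Mapping.lookup (act n g (Poly_Mapping.single t 1)) s" for s t
  interpret C: comm_ring_hom "Const :: 'k \<Rightarrow> (nat \<times> nat monom, 'k) mpoly" by (rule Const_hom)
  interpret \<tau>: comm_ring_hom "psubst ?\<tau>" by (rule psubst_hom)
  \<comment> \<open>\<open>ext_act_coeff\<close> has \<open>L\<close> along the rows, whereas in
    Cauchy-Binet the summation list \<open>L'\<close> indexes the rows of the second factor; hence
    the transpose.\<close>
  have coeff: "Const (ext_act_coeff n q g L L') =
      det (mat q q (\<lambda>(i, j). Const (a (L ! j) (L' ! i)) :: (nat \<times> nat monom, 'k) mpoly))" for L'
  proof -
    have "det (mat q q (\<lambda>(i, j). Const (a (L ! j) (L' ! i)) :: (nat \<times> nat monom, 'k) mpoly)) =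
        det (transpose_mat (mat q q (\<lambda>(i, j). Const (a (L ! i) (L' ! j)))))"
      by (rule arg_cong[of _ _ det], rule eq_matI) auto
    also have "\<dots> = det (mat q q (\<lambda>(i, j). Const (a (L ! i) (L' ! j))))"
      by (rule det_transpose[of _ q]) simp
    also have "\<dots> = det (map_mat Const (mat q q (\<lambda>(i, j). a (L ! i) (L' ! j))))"
      by (rule arg_cong[of _ _ det], rule eq_matI) auto
    finally show ?thesis by (simp add: C.hom_det ext_act_coeff_def a_def)
  qed
  have "psubst ?\<tau> (generic_minor q L) = det (map_mat (psubst ?\<tau>) (mat q q (\<lambda>(i, j). Var (i, L ! j))))"
    unfolding generic_minor_def by (rule \<tau>.hom_det[symmetric])
  also have "\<dots> = det (mat q q (\<lambda>(i, j). \<Sum>t\<in>terms_deg n m. Var (i, t) * Const (a (L ! j) t)))"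
    by (rule arg_cong[of _ _ det], rule eq_matI) (auto simp: a_def mult.commute)
  also have "\<dots> = (\<Sum>L'\<in>ext_terms n m q r. det (mat q q (\<lambda>(i, j). Var (i, L' ! j))) *
      det (mat q q (\<lambda>(i, j). Const (a (L ! j) (L' ! i)))))"
    by (rule cauchy_binet[where M = "\<lambda>i t. Var (i, t)" and N = "\<lambda>t j. Const (a (L ! j) t)"])
      (use ex_ext_term[OF r] ext_terms_unique[OF r] ext_terms_distinct[OF r] in
        \<open>auto simp: ext_terms_def finite_terms_deg\<close>)
  finally show ?thesis by (simp add: coeff generic_minor_def mult.commute)
qed

section \<open>Pullbacks and the Pluecker ideal\<close>

lemma pl_pullback_eq_eval:
  "pl_pullback n m q r g = eval_mpoly Const
    (\<lambda>L. \<Sum>L'\<in>ext_terms n m q r. Const (ext_act_coeff n q g L L') * Var L')"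
  by (simp add: pl_pullback_def psubst_eq_eval)

lemma pl_pullback_hom: "comm_ring_hom (pl_pullback n m q r g)"
  unfolding pl_pullback_def by (rule psubst_hom)

lemma pl_pullback_closed:
  assumes "p \<in> carrier (pl_ring n m q r)"
  shows "pl_pullback n m q r g p \<in> carrier (pl_ring n m q r)"
  using assms unfolding pl_ring_def pl_pullback_eq_eval
  by (rule eval_mpoly_in_subring[OF is_subring_poly_ring, rotated 2])
    (auto intro!: is_subring_sum[OF is_subring_poly_ring] is_subring_simps(4)[OF is_subring_poly_ring])

text \<open>By \<open>generic_minor_pullback\<close>, substituting the minors into the pulled-back
  polynomial amounts to substituting them into \<open>p\<close> and then applying the column
  substitution \<tau>, a homomorphism, which sends 0 to 0.\<close>

lemma pl_pullback_pl_ideal: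
  fixes g :: "'k::field mat"
  assumes r: "term_order n r" and p: "p \<in> pl_ideal n m q r"
  shows "pl_pullback n m q r g p \<in> pl_ideal n m q r"
proof -
  let ?E = "ext_terms n m q r"
  define \<tau> :: "nat \<times> nat monom \<Rightarrow> (nat \<times> nat monom, 'k) mpoly"
    where "\<tau> = (\<lambda>(i, s). \<Sum>t\<in>terms_deg n m.
      Const (Poly_Mapping.lookup (act n g (Poly_Mapping.single t 1)) s) * Var (i, t))"
  interpret G: comm_ring_hom "psubst (generic_minor q) :: 'k pl_poly \<Rightarrow> _" by (rule psubst_hom)
  interpret \<tau>: comm_ring_hom "psubst \<tau>" by (rule psubst_hom)
  have p': "p \<in> carrier (pl_ring n m q r)" "psubst (generic_minor q) p = 0"
    using p by (auto simp: pl_ideal_def)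
  have "psubst (generic_minor q) (pl_pullback n m q r g p) =
      eval_mpoly Const (\<lambda>L. \<Sum>L'\<in>?E. Const (ext_act_coeff n q g L L') * generic_minor q L') p"
    unfolding pl_pullback_eq_eval hom_eval_mpoly[OF psubst_hom] by (simp add: comp_def hom_distribs)
  also have "\<dots> = eval_mpoly Const (\<lambda>L. psubst \<tau> (generic_minor q L)) p"
    by (rule eval_mpoly_cong, unfold \<tau>_def, rule generic_minor_pullback[OF r])
      (use p' in \<open>auto simp: pl_ring_def poly_ring_carrier\<close>)
  also have "\<dots> = psubst \<tau> (psubst (generic_minor q) p)"
    by (simp add: psubst_eq_eval[of "generic_minor q"] hom_eval_mpoly[OF psubst_hom[of \<tau>]] comp_def)
  finally show ?thesis using p' pl_pullback_closed by (auto simp: pl_ideal_def)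
qed

section \<open>Points of the Grassmannian\<close>

lemma prime_in_preimage:
  assumes "comm_ring_hom h" "is_subring A" "prime_in B P" "\<And>a. a \<in> A \<Longrightarrow> h a \<in> B"
  shows "prime_in A {a \<in> A. h a \<in> P}"
proof -
  interpret comm_ring_hom h by fact
  interpret prime_in B P by fact
  show ?thesis
  proof
    fix x y assume "x \<in> A" "y \<in> A" "x * y \<in> {a \<in> A. h a \<in> P}"
    then show "x \<in> {a \<in> A. h a \<in> P} \<or> y \<in> {a \<in> A. h a \<in> P}"
      using P_prime[of "h x" "h y"] assms(4) by (auto simp: hom_distribs)
  qed (use is_subring_simps[OF assms(2)] assms P_zero P_one P_add P_mult in \<open>auto simp: hom_distribs\<close>)
qed

lemma prime_in_iff_primeideal:
  fixes P :: "('v, 'k::comm_ring_1) mpoly set"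
  shows "prime_in (carrier (Defs.poly_ring U)) P \<longleftrightarrow> primeideal P (Defs.poly_ring U)"
proof
  let ?R = "Defs.poly_ring U :: ('v, 'k) mpoly ring"
  interpret R: cring ?R by (rule cring_poly_ring)
  {
    assume "prime_in (carrier ?R) P"
    then interpret prime_in "carrier ?R" P .
    have "\<ominus>\<^bsub>?R\<^esub> x = - x" if "x \<in> carrier ?R" for x
      by (rule R.minus_equality) (use that S in auto)
    then have "subgroup P (add_monoid ?R)"
      using P_sub P_add P_zero P_uminus by unfold_locales (auto simp: a_inv_def subset_iff)
    then have "ideal P ?R"
      by (intro idealI R.ring_axioms) (auto intro: P_mult P_mult')
    then show "primeideal P ?R"
      by (rule primeidealI[OF _ R.is_cring]) (use P_one S P_prime in auto)
  }
  {
    assume "primeideal P ?R"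
    then interpret primeideal P ?R .
    show "prime_in (carrier ?R) P"
    proof
      show "1 \<notin> P"
        using one_imp_carrier I_notcarr by auto
    qed (use a_subset additive_subgroup.zero_closed[OF additive_subgroup_axioms]
        additive_subgroup.a_closed[OF additive_subgroup_axioms] I_l_closed I_prime
        in \<open>auto simp: is_subring_poly_ring\<close>)
  }
qed

section \<open>Homogeneous components\<close>

lemma lookup_hom_component:
  "Poly_Mapping.lookup (hom_component d p) t = (if mdeg t = d then Poly_Mapping.lookup p t else 0)"
  unfolding hom_component_def
  by (auto simp: lookup_sum lookup_single when_def in_keys_iff)

lemma keys_hom_component: "Poly_Mapping.keys (hom_component d p) = {t \<in> Poly_Mapping.keys p. mdeg t = d}"
  by (auto simp: in_keys_iff lookup_hom_component split: if_splits)

lemma hom_component_closed: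
  "p \<in> carrier (Defs.poly_ring U) \<Longrightarrow> hom_component d p \<in> carrier (Defs.poly_ring U)"
  by (auto simp: poly_ring_carrier keys_hom_component)

lemma hom_component_hom_component:
  "hom_component e (hom_component d p) = (if e = d then hom_component d p else 0)"
  by (rule poly_mapping_eqI) (auto simp: lookup_hom_component)

text \<open>Evaluation at the point \<open>\<sigma> X\<close>, which separates the homogeneous components by the powers of
  the extra variable \<open>X\<close>.\<close>

definition graded_eval :: "('k::comm_ring_1 \<Rightarrow> 'r::comm_ring_1) \<Rightarrow> ('v \<Rightarrow> 'r) \<Rightarrow> ('v, 'k) mpoly \<Rightarrow> 'r poly"
  where "graded_eval \<kappa> \<sigma> = eval_mpoly (\<lambda>c. [:\<kappa> c:]) (\<lambda>v. Polynomial.monom (\<sigma> v) 1)"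

lemma const_poly_hom:
  assumes "comm_ring_hom \<kappa>" shows "comm_ring_hom (\<lambda>c. [:\<kappa> c:])"
proof -
  interpret comm_ring_hom \<kappa> by fact
  show ?thesis by standard (auto simp: hom_distribs)
qed

lemma graded_eval_hom: "comm_ring_hom \<kappa> \<Longrightarrow> comm_ring_hom (graded_eval \<kappa> \<sigma>)"
  unfolding graded_eval_def by (intro eval_mpoly_hom const_poly_hom)

lemma prod_monom:
  "(\<Prod>v\<in>V. Polynomial.monom (f v) (k v)) = Polynomial.monom (\<Prod>v\<in>V. f v) (\<Sum>v\<in>V. k v)"
  by (induction V rule: infinite_finite_induct) (auto simp: mult_monom)

lemma coeff_graded_eval:
  assumes "comm_ring_hom \<kappa>"
  shows "poly.coeff (graded_eval \<kappa> \<sigma> p) d = eval_mpoly \<kappa> \<sigma> (hom_component d p)"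
proof -
  have "graded_eval \<kappa> \<sigma> p = (\<Sum>t\<in>Poly_Mapping.keys p.
      Polynomial.monom (\<kappa> (Poly_Mapping.lookup p t) * monom_at \<sigma> t) (mdeg t))"
    by (simp add: graded_eval_def eval_mpoly_def monom_power prod_monom mdeg_def smult_monom)
  then have "poly.coeff (graded_eval \<kappa> \<sigma> p) d =
      (\<Sum>t\<in>Poly_Mapping.keys p. if mdeg t = d then \<kappa> (Poly_Mapping.lookup p t) * monom_at \<sigma> t else 0)"
    by (simp add: coeff_sum)
  also have "\<dots> = (\<Sum>t\<in>{t \<in> Poly_Mapping.keys p. mdeg t = d}. \<kappa> (Poly_Mapping.lookup p t) * monom_at \<sigma> t)"
    by (simp add: sum.inter_filter)
  also have "\<dots> = eval_mpoly \<kappa> \<sigma> (hom_component d p)"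
    unfolding eval_mpoly_def keys_hom_component by (rule sum.cong) (auto simp: lookup_hom_component)
  finally show ?thesis .
qed

lemma graded_eval_eq_0_iff:
  assumes "comm_ring_hom \<kappa>"
  shows "graded_eval \<kappa> \<sigma> p = 0 \<longleftrightarrow> (\<forall>d. eval_mpoly \<kappa> \<sigma> (hom_component d p) = 0)"
  by (simp add: poly_eq_iff coeff_graded_eval[OF assms])

lemma graded_eval_hom_component:
  assumes "comm_ring_hom \<kappa>"
  shows "graded_eval \<kappa> \<sigma> (hom_component d p) = Polynomial.monom (eval_mpoly \<kappa> \<sigma> (hom_component d p)) d"
  by (rule poly_eqI)
    (auto simp: coeff_graded_eval[OF assms] hom_component_hom_component eval_mpoly_zero[OF assms])

lemma poly_graded_eval_1: "poly (graded_eval \<kappa> \<sigma> p) 1 = eval_mpoly \<kappa> \<sigma> p"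
  unfolding graded_eval_def hom_eval_mpoly[OF comm_ring_hom_poly] by (simp add: comp_def poly_monom)

lemma graded_eval_Var:
  "comm_ring_hom \<kappa> \<Longrightarrow> graded_eval \<kappa> \<sigma> (Var v) = Polynomial.monom (\<sigma> v) 1"
  unfolding graded_eval_def by (intro eval_mpoly_Var const_poly_hom)

lemma graded_eval_Const:
  "comm_ring_hom \<kappa> \<Longrightarrow> graded_eval \<kappa> \<sigma> (Const c) = [:\<kappa> c:]"
  unfolding graded_eval_def by (intro eval_mpoly_Const[where \<kappa> = "\<lambda>c. [:\<kappa> c:]"] const_poly_hom)

text \<open>With degrees marked by powers of \<open>X\<close>, the linear form \<sigma>(v) becomes
  \<sigma>(v) times \<open>X\<close>. So marking the degrees of the result of the substitution gives
  the same as marking those of \<open>p\<close> and then substituting, and the claim compares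
  coefficients of \<open>X ^ d\<close>.\<close>

lemma hom_component_psubst_linear:
  fixes c :: "'v \<Rightarrow> 'w \<Rightarrow> 'k::comm_ring_1" and A :: "'w set"
  defines "\<sigma> \<equiv> \<lambda>v. \<Sum>w\<in>A. Const (c v w) * Var w"
  shows "hom_component d (psubst \<sigma> p) = psubst \<sigma> (hom_component d p)"
proof -
  interpret G: comm_ring_hom "graded_eval Const Var :: ('w, 'k) mpoly \<Rightarrow> _"
    by (rule graded_eval_hom[OF Const_hom])
  have "graded_eval Const Var (\<sigma> v) = Polynomial.monom (\<sigma> v) 1" for v
    by (simp add: \<sigma>_def hom_distribs graded_eval_Var[OF Const_hom] graded_eval_Const[OF Const_hom]
        smult_monom monom_sum)
  then have "graded_eval Const Var (psubst \<sigma> p) = graded_eval Const \<sigma> p"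
    unfolding psubst_eq_eval hom_eval_mpoly[OF graded_eval_hom[OF Const_hom]]
    by (simp add: comp_def graded_eval_Const[OF Const_hom]) (simp add: graded_eval_def)
  then have "poly.coeff (graded_eval Const Var (psubst \<sigma> p)) d = poly.coeff (graded_eval Const \<sigma> p) d"
    by simp
  then show ?thesis
    unfolding coeff_graded_eval[OF Const_hom] mpoly_eq_eval psubst_eq_eval .
qed

section \<open>The action on points and the supports of orbits\<close>

lemma Gr_prime_in: "P \<in> Gr n m q r \<Longrightarrow> prime_in (carrier (pl_ring n m q r)) P"
  by (simp add: Gr_def pl_ring_def prime_in_iff_primeideal)

text \<open>For an arbitrary matrix the preimage of a point might contain every coordinate. The
  hypothesis says that \<open>Var L\<close> is outside it, so relevance comes from the very
  coordinate under study and not from an inverse of the pullback.\<close>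

lemma act_point_in_Gr:
  fixes V :: "'k::field point"
  assumes r: "term_order n r" and V: "V \<in> Gr n m q r"
    and L: "L \<in> ext_terms n m q r" "pl_pullback n m q r g (Var L) \<notin> V"
  shows "act_point n m q r g V \<in> Gr n m q r"
proof -
  let ?R = "pl_ring n m q r :: 'k pl_poly ring" and ?h = "pl_pullback n m q r g"
  have "prime_in (carrier ?R) (act_point n m q r g V)"
    unfolding act_point_def
    by (rule prime_in_preimage[OF pl_pullback_hom _ Gr_prime_in[OF V] pl_pullback_closed])
      (simp_all add: pl_ring_def is_subring_poly_ring)
  moreover have "homogeneous_set (act_point n m q r g V)"
    unfolding homogeneous_set_def
  proof (intro ballI allI)
    fix p d assume p: "p \<in> act_point n m q r g V"
    have "?h (hom_component d p) = hom_component d (?h p)"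
      by (simp add: pl_pullback_def hom_component_psubst_linear)
    then show "hom_component d p \<in> act_point n m q r g V"
      using p V by (auto simp: act_point_def pl_ring_def hom_component_closed Gr_def homogeneous_set_def)
  qed
  moreover have "Var L \<notin> act_point n m q r g V" using L by (simp add: act_point_def)
  moreover have "pl_ideal n m q r \<subseteq> act_point n m q r g V"
    using V pl_pullback_pl_ideal[OF r, of _ m q g]
    by (auto simp: act_point_def Gr_def pl_ideal_def)
  ultimately show ?thesis
    using L by (auto simp: Gr_def pl_ring_def prime_in_iff_primeideal)
qed

lemma Delta_Supp_eq:
  assumes "W \<subseteq> Gr n m q r"
  shows "Delta_Supp n m q r W = {L \<in> ext_terms n m q r. \<exists>V\<in>W. Var L \<notin> V}"
  using assms by (auto simp: Delta_Supp_def U_chart_def)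

text \<open>The right side speaks of functions on \<open>W\<close> alone. Hence \<open>gin\<close>
  of a closure, or of the closed points, can be treated without comparing the orbits
  topologically.\<close>

lemma Delta_Supp_orbit_eq:
  assumes r: "term_order n r" and W: "W \<subseteq> Gr n m q r"
  shows "Delta_Supp n m q r (orbit n m q r W) =
    {L \<in> ext_terms n m q r. \<exists>g\<in>GL (n + 1). \<exists>V\<in>W. pl_pullback n m q r g (Var L) \<notin> V}"
proof (intro equalityI subsetI)
  fix L assume "L \<in> Delta_Supp n m q r (orbit n m q r W)"
  then obtain g V where "L \<in> ext_terms n m q r" "g \<in> GL (n + 1)" "V \<in> W"
    "Var L \<notin> act_point n m q r g V"
    by (auto simp: Delta_Supp_def U_chart_def orbit_def)
  then show "L \<in> {L \<in> ext_terms n m q r. \<exists>g\<in>GL (n + 1). \<exists>V\<in>W. pl_pullback n m q r g (Var L) \<notin> V}"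
    by (auto simp: act_point_def pl_ring_def)
next
  fix L assume "L \<in> {L \<in> ext_terms n m q r. \<exists>g\<in>GL (n + 1). \<exists>V\<in>W. pl_pullback n m q r g (Var L) \<notin> V}"
  then obtain g V where L: "L \<in> ext_terms n m q r" "g \<in> GL (n + 1)" "V \<in> W"
    "pl_pullback n m q r g (Var L) \<notin> V" by blast
  then have "act_point n m q r g V \<in> Gr n m q r" using act_point_in_Gr[OF r] W by blast
  then have "act_point n m q r g V \<in> U_chart n m q r L \<inter> orbit n m q r W"
    using L by (auto simp: U_chart_def orbit_def act_point_def)
  then show "L \<in> Delta_Supp n m q r (orbit n m q r W)" using L by (auto simp: Delta_Supp_def)
qed

lemma in_ext_gin_ext_cong:
  assumes r: "term_order n r" and W: "W \<subseteq> Gr n m q r" "W' \<subseteq> Gr n m q r"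
    and eq: "\<And>f. f \<in> carrier (pl_ring n m q r) \<Longrightarrow> (\<exists>V\<in>W. f \<notin> V) \<longleftrightarrow> (\<exists>V\<in>W'. f \<notin> V)"
  shows "in_ext n m q r W = in_ext n m q r W' \<and> gin_ext n m q r W = gin_ext n m q r W'"
proof -
  have Var: "Var L \<in> carrier (pl_ring n m q r)" if "L \<in> ext_terms n m q r" for L
    using that by (simp add: pl_ring_def)
  have "Delta_Supp n m q r W = Delta_Supp n m q r W'"
    unfolding W[THEN Delta_Supp_eq] using eq[OF Var] by blast
  moreover have "Delta_Supp n m q r (orbit n m q r W) = Delta_Supp n m q r (orbit n m q r W')"
    unfolding W[THEN Delta_Supp_orbit_eq[OF r]] using eq[OF pl_pullback_closed[OF Var]] by blast
  ultimately show ?thesis by (simp add: in_ext_def gin_ext_def)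
qed

lemma ex_closure_iff:
  assumes "W \<subseteq> Gr n m q r" "f \<in> carrier (pl_ring n m q r)"
  shows "(\<exists>V\<in>Gr_top n m q r closure_of W. f \<notin> V) \<longleftrightarrow> (\<exists>V\<in>W. f \<notin> V)"
proof
  assume "\<exists>V\<in>Gr_top n m q r closure_of W. f \<notin> V"
  then obtain V where V: "V \<in> Gr_top n m q r closure_of W" "f \<notin> V" by blast
  let ?U = "{P \<in> Gr n m q r. \<not> {f} \<subseteq> P}"
  have "openin (Gr_top n m q r) ?U"
    unfolding openin_Gr_top zariski_open_def using assms by blast
  moreover have "V \<in> ?U" using V by (auto simp: in_closure_of)
  moreover have "\<forall>T. V \<in> T \<and> openin (Gr_top n m q r) T \<longrightarrow> (\<exists>P. P \<in> W \<and> P \<in> T)"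
    using V(1) unfolding in_closure_of by (rule conjunct2)
  ultimately have "\<exists>P. P \<in> W \<and> P \<in> ?U" by (elim allE[of _ ?U] impE) auto
  then show "\<exists>V\<in>W. f \<notin> V" by auto
next
  show "\<exists>V\<in>Gr_top n m q r closure_of W. f \<notin> V" if "\<exists>V\<in>W. f \<notin> V"
    using that closure_of_subset[of W "Gr_top n m q r"] assms by auto
qed

section \<open>Specialisation to closed points\<close>

lemma algebraic_nonzero_constant:
  fixes \<eta> :: "'k::field alg_closure"
  assumes "\<eta> \<noteq> 0"
  obtains p where "poly.coeff p 0 \<noteq> 0" "poly (map_poly to_ac p) \<eta> = 0"
proof -
  interpret comm_ring_hom "to_ac :: 'k \<Rightarrow> _" by (rule to_ac_hom)
  interpret M: map_poly_comm_ring_hom "to_ac :: 'k \<Rightarrow> _" ..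
  obtain p :: "'k poly" where p: "p \<noteq> 0" "poly (map_poly to_ac p) \<eta> = 0"
    by (rule alg_closure_algebraic)
  \<comment> \<open>Splitting off the power of \<open>X\<close> leaves a cofactor with nonzero
    constant coefficient, of which \<eta> \<noteq> 0 is still a root.\<close>
  obtain p' where p': "p = [:-0, 1:] ^ Polynomial.order 0 p * p'" "\<not> [:-0, 1:] dvd p'"
    using order_decomp[OF p(1)] by blast
  have "poly (map_poly to_ac p) \<eta> = \<eta> ^ Polynomial.order 0 p * poly (map_poly to_ac p') \<eta>"
    by (subst p'(1)) (simp add: hom_distribs)
  moreover have "poly.coeff p' 0 \<noteq> 0" using p'(2) poly_eq_0_iff_dvd[of p' 0] by (simp add: poly_0_coeff_0)
  ultimately show ?thesis using that p(2) assms by auto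
qed

lemma ex_closed_point:
  fixes V :: "'k::field point"
  assumes inf: "infinite (UNIV :: 'k set)" and V: "V \<in> Gr n m q r"
    and f: "f \<in> carrier (pl_ring n m q r)" "f \<notin> V"
  obtains P where "P \<in> Gr n m q r" "V \<subseteq> P" "f \<notin> P" "closedin (Gr_top n m q r) {P}"
proof -
  let ?E = "ext_terms n m q r"
  let ?S = "carrier (pl_ring n m q r) :: 'k pl_poly set"
  have S_eq: "?S = carrier (Defs.poly_ring ?E)" by (simp add: pl_ring_def)
  interpret V: prime_in ?S V by (rule Gr_prime_in[OF V])
  obtain L0 where L0: "L0 \<in> ?E" "Var L0 \<notin> V" using V by (auto simp: Gr_def)
  have L0S: "Var L0 \<in> ?S" using L0 by (simp add: S_eq)
  \<comment> \<open>The factor \<open>Var L0\<close> makes \<omega> nonzero at \<open>L0\<close>, so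
    that \<open>P\<close> below is relevant.\<close>
  have "f * Var L0 \<notin> V" "f * Var L0 \<in> ?S" using V.P_prime L0 L0S f V.S by auto
  from nullstellensatz[OF inf finite_ext_terms[of n m q r] V.prime_in_axioms[unfolded S_eq] this(2)[unfolded S_eq] this(1)]
  obtain \<omega> :: "ext_term \<Rightarrow> 'k alg_closure" where
    \<omega>: "\<And>p. p \<in> V \<Longrightarrow> eval_mpoly to_ac \<omega> p = 0" "eval_mpoly to_ac \<omega> (f * Var L0) \<noteq> 0"
    by blast
  define \<gamma> where "\<gamma> = (graded_eval to_ac \<omega> :: 'k pl_poly \<Rightarrow> _)"
  interpret \<gamma>: comm_ring_hom \<gamma> unfolding \<gamma>_def by (rule graded_eval_hom[OF to_ac_hom])
  define P where "P = {p \<in> ?S. \<gamma> p = 0}"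
  have P_iff: "p \<in> P \<longleftrightarrow> p \<in> ?S \<and> (\<forall>d. eval_mpoly to_ac \<omega> (hom_component d p) = 0)" for p
    by (simp add: P_def \<gamma>_def graded_eval_eq_0_iff[OF to_ac_hom])
  have prime: "prime_in ?S P" unfolding P_def
    by (rule prime_in_kernel[OF \<gamma>.comm_ring_hom_axioms V.sub])
  have "V \<subseteq> P"
    using V V.P_sub \<omega>(1) by (auto simp: P_iff Gr_def homogeneous_set_def)
  \<comment> \<open>Setting \<open>X = 1\<close> in \<gamma> recovers evaluation at \<omega>; as
    \<gamma> is multiplicative, neither factor lies in its kernel.\<close>
  have "\<gamma> (f * Var L0) \<noteq> 0"
    using \<omega>(2) poly_graded_eval_1[of to_ac \<omega> "f * Var L0"] by (auto simp: \<gamma>_def)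
  then have "f \<notin> P" "Var L0 \<notin> P" by (auto simp: P_def hom_distribs)
  have "homogeneous_set P" unfolding homogeneous_set_def
    by (auto simp: P_iff hom_component_hom_component S_eq hom_component_closed eval_mpoly_zero[OF to_ac_hom])
  then have PG: "P \<in> Gr n m q r"
    using prime \<open>V \<subseteq> P\<close> \<open>Var L0 \<notin> P\<close> L0 V
    by (auto simp: Gr_def pl_ring_def prime_in_iff_primeideal)
  have "Q \<subseteq> P" if Q: "Q \<in> Gr n m q r" "P \<subseteq> Q" for Q
  proof
    interpret Q: prime_in ?S Q by (rule Gr_prime_in[OF Q(1)])
    \<comment> \<open>Relevance of \<open>Q\<close> provides a coordinate \<open>?y\<close> outside
      \<open>Q\<close>, hence outside \<open>P\<close>: a denominator that does not vanish at
      \<omega>.\<close>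
    obtain L1 where L1: "L1 \<in> ?E" "Var L1 \<notin> Q" using Q by (auto simp: Gr_def)
    let ?y = "Var L1 :: 'k pl_poly"
    have yS: "?y \<in> ?S" using L1 by (simp add: S_eq)
    have "\<gamma> ?y \<noteq> 0" using L1 Q yS by (auto simp: P_def)
    then have \<omega>1: "\<omega> L1 \<noteq> 0" by (auto simp: \<gamma>_def graded_eval_Var[OF to_ac_hom])
    fix p assume p: "p \<in> Q"
    have "eval_mpoly to_ac \<omega> (hom_component d p) = 0" for d
    proof (rule ccontr)
      define h where "h = hom_component d p"
      define c where "c = eval_mpoly to_ac \<omega> h"
      assume "eval_mpoly to_ac \<omega> (hom_component d p) \<noteq> 0"
      then have "c \<noteq> 0" by (simp add: c_def h_def)
      have hQ: "h \<in> Q" using Q p by (auto simp: h_def Gr_def homogeneous_set_def)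
      then have hS: "h \<in> ?S" using Q.P_sub by blast
      \<comment> \<open>The value at \<omega> of the fraction \<open>h / ?y ^ d\<close> of degree 0,
        algebraic over the ground field.\<close>
      define \<eta> where "\<eta> = c / \<omega> L1 ^ d"
      have "\<eta> \<noteq> 0" using \<open>c \<noteq> 0\<close> \<omega>1 by (simp add: \<eta>_def)
      then obtain u where u: "poly.coeff u 0 \<noteq> 0" "poly (map_poly to_ac u) \<eta> = 0"
        by (rule algebraic_nonzero_constant)
      define N where "N = Polynomial.degree u"
      \<comment> \<open>The terms of u(h / y^d) multiplied by y^(d N), with y for \<open>?y\<close>.
        They are forms of the same degree, so \<gamma> maps their sum to one monomial, whose
        coefficient is a multiple of u(\<eta>) = 0.\<close>
      define F where "F i = Const (poly.coeff u i) * h ^ i * ?y ^ (d * (N - i))" for i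
      have CS: "Const a \<in> ?S" for a by (simp add: S_eq)
      have FS: "F i \<in> ?S" for i using V.S CS hS yS by (auto simp: F_def)
      have "\<gamma> h = Polynomial.monom c d"
        by (simp add: h_def c_def \<gamma>_def graded_eval_hom_component[OF to_ac_hom])
      then have \<gamma>F: "\<gamma> (F i) = Polynomial.monom (\<omega> L1 ^ (d * N) * (to_ac (poly.coeff u i) * \<eta> ^ i)) (d * N)"
        if "i \<le> N" for i
      proof -
        have e: "d * i + d * (N - i) = d * N" using that by (simp flip: distrib_left)
        have "c ^ i = \<eta> ^ i * \<omega> L1 ^ (d * i)"
          using \<omega>1 by (simp add: \<eta>_def power_divide power_mult)
        then have "to_ac (poly.coeff u i) * c ^ i * \<omega> L1 ^ (d * (N - i)) =
            to_ac (poly.coeff u i) * \<eta> ^ i * (\<omega> L1 ^ (d * i) * \<omega> L1 ^ (d * (N - i)))"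
          by (simp only: mult.assoc)
        also have "\<dots> = \<omega> L1 ^ (d * N) * (to_ac (poly.coeff u i) * \<eta> ^ i)"
          by (simp only: power_add[symmetric] e mult.commute)
        finally have coeff: "to_ac (poly.coeff u i) * c ^ i * \<omega> L1 ^ (d * (N - i)) = \<dots>" .
        have "\<gamma> (F i) = Polynomial.smult (to_ac (poly.coeff u i)) (Polynomial.monom c d ^ i) *
            Polynomial.monom (\<omega> L1) 1 ^ (d * (N - i))"
          unfolding F_def \<gamma>.hom_mult \<gamma>.hom_power \<open>\<gamma> h = _\<close>
          by (simp add: \<gamma>_def graded_eval_Var[OF to_ac_hom] graded_eval_Const[OF to_ac_hom])
        also have "\<dots> = Polynomial.monom (to_ac (poly.coeff u i) * c ^ i * \<omega> L1 ^ (d * (N - i)))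
            (d * i + d * (N - i))"
          by (simp add: monom_power mult_monom smult_monom)
        finally show ?thesis unfolding coeff e .
      qed
      have "poly (map_poly to_ac u) \<eta> = (\<Sum>i\<le>N. to_ac (poly.coeff u i) * \<eta> ^ i)"
        by (simp add: poly_altdef N_def degree_map_poly coeff_map_poly)
      moreover have "\<gamma> (\<Sum>i\<le>N. F i) = (\<Sum>i\<le>N.
          Polynomial.monom (\<omega> L1 ^ (d * N) * (to_ac (poly.coeff u i) * \<eta> ^ i)) (d * N))"
        unfolding \<gamma>.hom_sum by (rule sum.cong) (auto simp: \<gamma>F)
      ultimately have "\<gamma> (\<Sum>i\<le>N. F i) =
          Polynomial.monom (\<omega> L1 ^ (d * N) * poly (map_poly to_ac u) \<eta>) (d * N)"
        unfolding monom_sum[symmetric] sum_distrib_left[symmetric] by simp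
      then have "\<gamma> (\<Sum>i\<le>N. F i) = 0" by (simp add: u)
      then have "(\<Sum>i\<le>N. F i) \<in> Q"
        using Q is_subring_sum[OF V.sub, of "{..N}" F] FS by (auto simp: P_def)
      moreover have "(\<Sum>i\<in>{..N} - {0}. F i) \<in> Q"
      proof (rule Q.P_sum)
        fix i assume "i \<in> {..N} - {0}"
        then obtain j where "i = Suc j" by (cases i) auto
        then have "F i = h * (Const (poly.coeff u i) * h ^ j * ?y ^ (d * (N - i)))"
          by (simp add: F_def ac_simps)
        then show "F i \<in> Q" using Q.P_mult' hQ V.S CS hS yS by auto
      qed
      \<comment> \<open>Only the constant term of \<open>u\<close> is left: a nonzero scalar times a
        power of \<open>?y\<close>, which a prime without \<open>?y\<close> cannot contain.\<close>
      ultimately have "F 0 \<in> Q"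
        using sum.remove[of "{..N}" 0 F] Q.P_diff[of "\<Sum>i\<le>N. F i" "\<Sum>i\<in>{..N} - {0}. F i"] by simp
      then have "Const (1 / poly.coeff u 0) * F 0 \<in> Q" using Q.P_mult CS by blast
      moreover have "Const (1 / poly.coeff u 0) * F 0 = ?y ^ (d * N)"
        using u(1) by (simp add: F_def Const_def mult_single mult.assoc[symmetric])
      ultimately show False using Q.P_power yS L1 by metis
    qed
    then show "p \<in> P" using p Q.P_sub by (auto simp: P_iff)
  qed
  \<comment> \<open>By maximality \<open>{P}\<close> is the closed set of all points containing
    \<open>P\<close>.\<close>
  then have "{P} = Gr n m q r - {Q \<in> Gr n m q r. \<not> P \<subseteq> Q}" using PG by blast
  moreover have "zariski_open n m q r {Q \<in> Gr n m q r. \<not> P \<subseteq> Q}"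
    unfolding zariski_open_def by (rule exI[of _ P]) (auto simp: P_def)
  ultimately have "closedin (Gr_top n m q r) {P}"
    using PG by (auto simp: closedin_def openin_Gr_top double_diff)
  then show ?thesis using that PG \<open>V \<subseteq> P\<close> \<open>f \<notin> P\<close> by blast
qed

lemma ex_closed_points_iff:
  fixes W :: "'k::field point set"
  assumes inf: "infinite (UNIV :: 'k set)" and W: "closedin (Gr_top n m q r) W"
    and f: "f \<in> carrier (pl_ring n m q r)"
  shows "(\<exists>V\<in>W. f \<notin> V) \<longleftrightarrow> (\<exists>V\<in>closed_points (Gr_top n m q r) W. f \<notin> V)"
proof
  assume "\<exists>V\<in>W. f \<notin> V"
  then obtain V where V: "V \<in> W" "f \<notin> V" by blast
  have WG: "W \<subseteq> Gr n m q r" using closedin_subset[OF W] by simp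
  have "openin (Gr_top n m q r) (Gr n m q r - W)" using W by (simp add: closedin_def)
  then obtain E where E: "Gr n m q r - W = {P \<in> Gr n m q r. \<not> E \<subseteq> P}"
    by (auto simp: openin_Gr_top zariski_open_def)
  obtain P where P: "P \<in> Gr n m q r" "V \<subseteq> P" "f \<notin> P" "closedin (Gr_top n m q r) {P}"
    by (rule ex_closed_point[OF inf _ f V(2)]) (use V WG in auto)
  \<comment> \<open>A closed set, being given by containment of \<open>E\<close>, contains with
    \<open>V\<close> every point above \<open>V\<close>.\<close>
  have "E \<subseteq> V" using E V WG by blast
  then have "P \<in> W" using E P by blast
  then show "\<exists>V\<in>closed_points (Gr_top n m q r) W. f \<notin> V" using P by (auto simp: closed_points_def)
qed (auto simp: closed_points_def)

theorem proposition2p9: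
  fixes n m q :: nat
    and r :: "nat monom rel"
    and W :: "'k::field point set"
  assumes "infinite (UNIV :: 'k set)"
    and "m > 0" and "q > 0"
    and "term_order n r"
    and "\<forall>i j. i < j \<and> j \<le> n \<longrightarrow> (Poly_Mapping.single i 1, Poly_Mapping.single j 1) \<in> r"
    and "W \<subseteq> Gr n m q r" and "W \<noteq> {}"
  shows "(in_ext n m q r W = in_ext n m q r (Gr_top n m q r closure_of W) \<and>
          gin_ext n m q r W = gin_ext n m q r (Gr_top n m q r closure_of W)) \<and>
         (closedin (Gr_top n m q r) W \<longrightarrow>
          in_ext n m q r W = in_ext n m q r (closed_points (Gr_top n m q r) W) \<and>
          gin_ext n m q r W = gin_ext n m q r (closed_points (Gr_top n m q r) W)) \<and>
         (\<forall>V. closedin (Gr_top n m q r) W \<and> irreducible_subset (Gr_top n m q r) W \<and>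
              generic_point (Gr_top n m q r) W V \<longrightarrow>
          in_ext n m q r W = in_ext n m q r {V} \<and> gin_ext n m q r W = gin_ext n m q r {V})"
proof -
  have closure: "in_ext n m q r Z = in_ext n m q r (Gr_top n m q r closure_of Z) \<and>
      gin_ext n m q r Z = gin_ext n m q r (Gr_top n m q r closure_of Z)"
    if "Z \<subseteq> Gr n m q r" for Z :: "'k point set"
    using in_ext_gin_ext_cong[OF assms(4) that _ ex_closure_iff[OF that, symmetric]]
      closure_of_subset_topspace[of "Gr_top n m q r" Z] by simp
  have "in_ext n m q r W = in_ext n m q r (closed_points (Gr_top n m q r) W) \<and>
      gin_ext n m q r W = gin_ext n m q r (closed_points (Gr_top n m q r) W)"
    if "closedin (Gr_top n m q r) W"
  proof (rule in_ext_gin_ext_cong[OF assms(4,6) _ ex_closed_points_iff[OF assms(1) that]])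
    show "closed_points (Gr_top n m q r) W \<subseteq> Gr n m q r"
      using assms(6) by (auto simp: closed_points_def)
  qed
  moreover have "in_ext n m q r W = in_ext n m q r {V} \<and> gin_ext n m q r W = gin_ext n m q r {V}"
    if "generic_point (Gr_top n m q r) W V" for V
    using closure[of "{V}"] that assms(6) by (auto simp: generic_point_def)
  ultimately show ?thesis using closure[OF assms(6)] by blast
qed

end
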